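(* Let $F$ be a field of characteristic $\neq 2$ and $\alpha,\beta,\gamma\in F^\times$. Let $V$ be the 7-dimensional $F$-vector space with basis $v_0,\dots,v_6$ (indices in $\mathbb{Z}/7\mathbb{Z}$), and let $l_n=\{v_n,v_{n+1},v_{n+3}\}$ ($n\in\mathbb{Z}/7$) be the lines of the Fano plane on these points. Fix $\varepsilon\in\{0,1\}$ and equip each line with the cyclic order $(v_n,v_{n+1},v_{n+3})$ if $\varepsilon=0$, resp. $(v_{n+1},v_n,v_{n+3})$ if $\varepsilon=1$ (the same choice for all $n$). Define $h(l_1)=-\alpha$, $h(l_{-1})=-\beta$, $h(l_0)=-\gamma$ and $h(l_n)=1$ for $n\notin\{-1,0,1\}$. Let $W=\bigwedge^3V$, $\Delta=v_0\wedge v_1\wedge\cdots\wedge v_6\in\bigwedge^7V$, and for each line $l$ with cyclic order $(u_1,u_2,u_3)$ put $w_l=h(l)\,u_1\wedge u_2\wedge u_3\in W$. For each $j$ define the linear functional $\eta_{v_j}:W\to F$ by $v_j\wedge\big(\sum_{n}w_{l_n}\big)\wedge w=\eta_{v_j}(w)\Delta$. Let $$\mathfrak{B}=\{B\subseteq V \text{ 3-dimensional}: \eta_{v_j}(b_1\wedge b_2\wedge b_3)=0 \text{ for all } j, \text{ where } b_1,b_2,b_3 \text{ is a basis of } B\}.$$ Then $\mathfrak{B}$ is an inclusion-minimal $(7,3,2)$ $q$-covering design on $V$. Moreover, if the equation $$\lambda_0^2-\lambda_1^2\alpha-\lambda_2^2\beta-\lambda_3^2\gamma+\lambda_4^2\alpha\beta+\lambda_5^2\beta\gamma+\lambda_6^2\gamma\alpha-\lambda_7^2\alpha\beta\gamma=0$$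 has only the solution $\lambda_0=\dots=\lambda_7=0$ in $F$ (equivalently, the Cayley algebra $D_\gamma(D_\beta(D_\alpha(F)))$ is a division algebra), then $\mathfrak{B}$ is a $2$-$(7,3,1)$ subspace design ($q$-Fano plane) on $V$. (In particular, with $\alpha=\beta=\gamma=-1$ and $F\subseteq\mathbb{R}$, $\mathfrak{B}$ is a $q$-Fano plane.)
   Context: The condition $\eta_{v_j}(b_1\wedge b_2\wedge b_3)=0$ does not depend on the choice of basis of $B$. A $(v,k,t)$ $q$-covering design on a $v$-dimensional space is a set of $k$-dimensional subspaces such that every $t$-dimensional subspace lies in at least one of them; it is inclusion-minimal if no proper subset has this property. A $2$-$(7,3,1)$ subspace design: every 2-dimensional subspace lies in exactly one block. Cayley–Dickson doubling: for an algebra $A$ with involution $*$ and $\gamma\in F^\times$, $D_\gamma(A)=A\oplus A$ (elements $a+ib$) with $(a+ib)(c+id)=(ac+\gamma db^* )+i(a^*d+cb)$ and $(a+ib)^*=a^*-ib$, starting from $F$ with identity involution. *)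

theory Defs
  imports "HOL-Analysis.Analysis" "HOL-Library.Numeral_Type"
begin

text \<open>V = F^7 with standard basis v_0..v_6; indices live in the ring type 7 = Z/7Z.\<close>

definition fv :: "7 \<Rightarrow> 'a::field ^ 7" where
  "fv j = axis j 1"

definition line_pts :: "nat \<Rightarrow> 7 \<Rightarrow> ('a::field ^ 7) \<times> ('a ^ 7) \<times> ('a ^ 7)" where
  "line_pts eps n = (if eps = 0 then (fv n, fv (n + 1), fv (n + 3))
                     else (fv (n + 1), fv n, fv (n + 3)))"

definition hval :: "'a::field \<Rightarrow> 'a \<Rightarrow> 'a \<Rightarrow> 7 \<Rightarrow> 'a" where
  "hval \<alpha> \<beta> \<gamma> n = (if n = 1 then - \<alpha> else if n = - 1 then - \<beta> else if n = 0 then - \<gamma> else 1)"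

text \<open>Coefficient of x_0 \<and> ... \<and> x_6 w.r.t. \<Delta> = v_0 \<and> ... \<and> v_6: the determinant of the
  matrix with rows x_0,...,x_6 (coordinates in the basis v).\<close>
definition wedge7 :: "'a::field ^ 7 \<Rightarrow> 'a ^ 7 \<Rightarrow> 'a ^ 7 \<Rightarrow> 'a ^ 7 \<Rightarrow> 'a ^ 7 \<Rightarrow> 'a ^ 7 \<Rightarrow> 'a ^ 7 \<Rightarrow> 'a" where
  "wedge7 x0 x1 x2 x3 x4 x5 x6 =
     det ((\<chi> i. if i = 0 then x0 else if i = 1 then x1 else if i = 2 then x2 else
                if i = 3 then x3 else if i = 4 then x4 else if i = 5 then x5 else x6) :: 'a ^ 7 ^ 7)"

text \<open>\<eta>_{v_j}(b_1 \<and> b_2 \<and> b_3), defined by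
  v_j \<and> (\<Sum>_n w_{l_n}) \<and> b_1 \<and> b_2 \<and> b_3 = \<eta>_{v_j}(b_1 \<and> b_2 \<and> b_3) \<Delta>,
  where w_l = h(l) u_1 \<and> u_2 \<and> u_3; expanded by multilinearity.\<close>
definition eta :: "nat \<Rightarrow> 'a::field \<Rightarrow> 'a \<Rightarrow> 'a \<Rightarrow> 7 \<Rightarrow> 'a ^ 7 \<Rightarrow> 'a ^ 7 \<Rightarrow> 'a ^ 7 \<Rightarrow> 'a" where
  "eta eps \<alpha> \<beta> \<gamma> j b1 b2 b3 =
     (\<Sum>n\<in>UNIV. hval \<alpha> \<beta> \<gamma> n *
        (case line_pts eps n of (u1, u2, u3) \<Rightarrow> wedge7 (fv j) u1 u2 u3 b1 b2 b3))"

definition frakB :: "nat \<Rightarrow> 'a::field \<Rightarrow> 'a \<Rightarrow> 'a \<Rightarrow> ('a ^ 7) set set" where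
  "frakB eps \<alpha> \<beta> \<gamma> = {B. vec.subspace B \<and> vec.dim B = 3 \<and>
      (\<forall>b1 b2 b3. vec.independent {b1, b2, b3} \<and> card {b1, b2, b3} = 3 \<and> vec.span {b1, b2, b3} = B
          \<longrightarrow> (\<forall>j. eta eps \<alpha> \<beta> \<gamma> j b1 b2 b3 = 0))}"

text \<open>(v,k,t) q-covering design on V = F^n (v = n = CARD('n)).\<close>
definition q_covering :: "('a::field ^ 'n) set set \<Rightarrow> nat \<Rightarrow> nat \<Rightarrow> bool" where
  "q_covering \<B> k t \<longleftrightarrow>
     (\<forall>B\<in>\<B>. vec.subspace B \<and> vec.dim B = k) \<and>
     (\<forall>T. vec.subspace T \<and> vec.dim T = t \<longrightarrow> (\<exists>B\<in>\<B>. T \<subseteq> B))"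

definition min_q_covering :: "('a::field ^ 'n) set set \<Rightarrow> nat \<Rightarrow> nat \<Rightarrow> bool" where
  "min_q_covering \<B> k t \<longleftrightarrow> q_covering \<B> k t \<and> (\<forall>\<C>. \<C> \<subset> \<B> \<longrightarrow> \<not> q_covering \<C> k t)"

definition q_steiner :: "('a::field ^ 'n) set set \<Rightarrow> nat \<Rightarrow> nat \<Rightarrow> bool" where
  "q_steiner \<B> k t \<longleftrightarrow>
     (\<forall>B\<in>\<B>. vec.subspace B \<and> vec.dim B = k) \<and>
     (\<forall>T. vec.subspace T \<and> vec.dim T = t \<longrightarrow> (\<exists>!B. B \<in> \<B> \<and> T \<subseteq> B))"

end

(* Let W be the trivector in the definition of the blocks, and let psi(x,y,z,w) be the alternating 4-form
   given by W \<and> x \<and> y \<and> z \<and> w.  A 3-space is a block iff psi(x,y,z,-) = 0 on it.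

   Covering: for independent x, y the alternating form psi(x,y,-,-) lives on the quotient V/span(x,y)
   of odd dimension 5, so it is degenerate, and some z outside span(x,y) satisfies psi(x,y,z,-) = 0.

   Uniqueness: let x \<times> y be the rescaled product of imaginary octonions.  The square of the 2-form
   psi(x,y,-,-) is dual to x \<and> y \<and> (x \<times> y).  So if x \<times> y is not in span(x,y), then psi(x,y,z,-) = 0
   forces z into span(x, y, x \<times> y), and span(x,y) lies in exactly one block.

   Minimality: if x \<times> y were in span(x,y) for all x, y in a block, then x \<times> y = f(x) y - f(y) x for a
   linear form f on it, so the symmetric tensor (x \<times> y)z + (y \<times> z)x + (z \<times> x)y vanishes.  Together
   with psi(x,y,z,-) = 0 this forces x \<and> y \<and> z = 0.

   Steiner property: with N the norm and b its polarization, x \<times> (x \<times> y) = b(x,y) x - N(x) y.  So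
   x \<times> y = rx + sy gives s^2 + N(x) = 0, and s^2 + N(x) is the given form in eight variables. *)

theory Submission
  imports Defs
begin

section \<open>Minors of tuples of vectors\<close>

text \<open>The minors are explicit Laplace expansions along the first vector rather than
  determinants, so that relations between them are polynomial identities over any commutative
  ring.\<close>

definition minor2 :: "'n::finite \<Rightarrow> 'n \<Rightarrow> 'a::comm_ring_1 ^ 'n \<Rightarrow> 'a ^ 'n \<Rightarrow> 'a" where
  "minor2 i j x y = x $ i * y $ j - x $ j * y $ i"

definition minor3 :: "'n::finite \<Rightarrow> 'n \<Rightarrow> 'n \<Rightarrow> 'a::comm_ring_1 ^ 'n \<Rightarrow> 'a ^ 'n \<Rightarrow> 'a ^ 'n \<Rightarrow> 'a" where
  "minor3 i j k x y z = x $ i * minor2 j k y z - x $ j * minor2 i k y z + x $ k * minor2 i j y z"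

definition minor4 ::
  "'n::finite \<Rightarrow> 'n \<Rightarrow> 'n \<Rightarrow> 'n \<Rightarrow> 'a::comm_ring_1 ^ 'n \<Rightarrow> 'a ^ 'n \<Rightarrow> 'a ^ 'n \<Rightarrow> 'a ^ 'n \<Rightarrow> 'a" where
  "minor4 i j k l w x y z = w $ i * minor3 j k l x y z - w $ j * minor3 i k l x y z
     + w $ k * minor3 i j l x y z - w $ l * minor3 i j k x y z"

lemmas minor_defs = minor4_def minor3_def minor2_def

lemma in_span_pair_iff:
  fixes x y z :: "'a::field ^ 'n::finite"
  shows "z \<in> vec.span {x, y} \<longleftrightarrow> (\<exists>a b. z = a *s x + b *s y)"
proof
  assume "z \<in> vec.span {x, y}"
  then obtain a b where "z - a *s x - b *s y \<in> vec.span {}"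
    by (metis vec.span_breakdown_eq)
  then show "\<exists>a b. z = a *s x + b *s y"
    by (metis vec.span_empty singletonD diff_diff_add eq_iff_diff_eq_0)
next
  show "\<exists>a b. z = a *s x + b *s y \<Longrightarrow> z \<in> vec.span {x, y}"
    by (elim exE) (simp add: vec.span_add vec.span_scale vec.span_base)
qed

lemma in_span_triple_iff:
  fixes x y z w :: "'a::field ^ 'n::finite"
  shows "w \<in> vec.span {x, y, z} \<longleftrightarrow> (\<exists>a b c. w = a *s x + b *s y + c *s z)"
proof
  assume "w \<in> vec.span {x, y, z}"
  then obtain a where "w - a *s x \<in> vec.span {y, z}"
    by (metis vec.span_breakdown_eq)
  then obtain b c where "w - a *s x = b *s y + c *s z"
    by (auto simp: in_span_pair_iff)
  then show "\<exists>a b c. w = a *s x + b *s y + c *s z"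
    by (metis add.assoc diff_eq_eq add.commute)
next
  show "\<exists>a b c. w = a *s x + b *s y + c *s z \<Longrightarrow> w \<in> vec.span {x, y, z}"
    by (elim exE) (simp add: vec.span_add vec.span_scale vec.span_base)
qed

lemma independent_pair_iff:
  fixes x y :: "'a::field ^ 'n::finite"
  shows "vec.independent {x, y} \<and> x \<noteq> y \<longleftrightarrow> (\<exists>i j. minor2 i j x y \<noteq> 0)"
proof
  assume ind: "vec.independent {x, y} \<and> x \<noteq> y"
  show "\<exists>i j. minor2 i j x y \<noteq> 0"
  proof (rule ccontr)
    assume "\<nexists>i j. minor2 i j x y \<noteq> 0"
    then have eq: "x $ i * y $ j = x $ j * y $ i" for i j
      by (auto simp: minor2_def)
    have "y \<noteq> 0"
      using ind vec.dependent_zero by blast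
    then obtain i where i: "y $ i \<noteq> 0"
      by (auto simp: vec_eq_iff)
    then have "x = (x $ i / y $ i) *s y"
      using eq[of i] by (simp add: vec_eq_iff field_simps)
    then have "x \<in> vec.span {y}"
      by (metis insertI1 vec.span_base vec.span_scale)
    then show False
      using ind by (simp add: vec.independent_insert)
  qed
next
  assume "\<exists>i j. minor2 i j x y \<noteq> 0"
  then obtain i j where ij: "minor2 i j x y \<noteq> 0" by blast
  have "y \<noteq> 0" "x \<noteq> y"
    using ij by (auto simp: minor2_def)
  moreover have "x \<notin> vec.span {y}"
    using ij by (auto simp: minor2_def vec.span_singleton)
  ultimately show "vec.independent {x, y} \<and> x \<noteq> y"
    by (simp add: vec.independent_insert)
qed

text \<open>Cramer's rule with \<open>minor2 i j x y\<close> as pivot: it suffices that the 3-minors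
  containing the pivot coordinates vanish.\<close>

lemma in_span_pair_minor:
  fixes x y z :: "'a::field ^ 'n::finite"
  assumes "minor2 i j x y \<noteq> 0"
  shows "z \<in> vec.span {x, y} \<longleftrightarrow> (\<forall>k. minor3 i j k x y z = 0)"
proof
  assume "z \<in> vec.span {x, y}"
  then obtain a b where "z = a *s x + b *s y"
    unfolding in_span_pair_iff by blast
  then show "\<forall>k. minor3 i j k x y z = 0"
    by (simp add: minor_defs algebra_simps)
next
  assume 0: "\<forall>k. minor3 i j k x y z = 0"
  have "minor2 i j x y * z $ k = minor2 i j z y * x $ k + minor2 i j x z * y $ k" for k
    using 0[rule_format, of k] by (simp add: minor_defs algebra_simps)
  then have "z = (minor2 i j z y / minor2 i j x y) *s x + (minor2 i j x z / minor2 i j x y) *s y"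
    using assms by (simp add: vec_eq_iff field_simps)
  then show "z \<in> vec.span {x, y}"
    unfolding in_span_pair_iff by blast
qed

lemma in_span_tripleI:
  fixes x y z w :: "'a::field ^ 'n::finite"
  assumes "minor3 i j k x y z \<noteq> 0" and "\<And>l. minor4 i j k l x y z w = 0"
  shows "w \<in> vec.span {x, y, z}"
proof -
  have "minor3 i j k x y z * w $ l
      = minor3 i j k w y z * x $ l + minor3 i j k x w z * y $ l + minor3 i j k x y w * z $ l" for l
    using assms(2)[of l] by (simp add: minor_defs algebra_simps)
  then have "w = (minor3 i j k w y z / minor3 i j k x y z) *s x
      + (minor3 i j k x w z / minor3 i j k x y z) *s y + (minor3 i j k x y w / minor3 i j k x y z) *s z"
    using assms(1) by (simp add: vec_eq_iff field_simps)
  then show ?thesis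
    unfolding in_span_triple_iff by blast
qed

lemma independent_triple_iff:
  fixes x y z :: "'a::field ^ 'n::finite"
  shows "vec.independent {x, y, z} \<and> card {x, y, z} = 3 \<longleftrightarrow>
    (\<exists>i j. minor2 i j x y \<noteq> 0) \<and> z \<notin> vec.span {x, y}"
proof -
  have "vec.independent {x, y, z} \<and> card {x, y, z} = 3 \<longleftrightarrow>
    (vec.independent {x, y} \<and> x \<noteq> y) \<and> z \<notin> vec.span {x, y}"
    by (auto simp: insert_commute[of _ z] vec.independent_insert card_insert_if vec.span_base split: if_splits)
  then show ?thesis
    unfolding independent_pair_iff .
qed

lemma dim_span_pair:
  fixes x y :: "'a::field ^ 'n::finite"
  assumes "minor2 i j x y \<noteq> 0"
  shows "vec.dim (vec.span {x, y}) = 2"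
proof -
  have "vec.independent {x, y} \<and> x \<noteq> y"
    using assms independent_pair_iff by blast
  then show ?thesis
    using vec.dim_eq_card_independent[of "{x, y}"] by simp
qed

lemma dim_span_triple:
  fixes x y z :: "'a::field ^ 'n::finite"
  assumes "minor2 i j x y \<noteq> 0" and "z \<notin> vec.span {x, y}"
  shows "vec.dim (vec.span {x, y, z}) = 3"
proof -
  have "vec.independent {x, y, z} \<and> card {x, y, z} = 3"
    using assms independent_triple_iff by blast
  then show ?thesis
    using vec.dim_eq_card_independent[of "{x, y, z}"] by simp
qed

lemma subspace_dim_2E:
  fixes T :: "('a::field ^ 'n::finite) set"
  assumes "vec.subspace T" and "vec.dim T = 2"
  obtains x y i j where "T = vec.span {x, y}" and "minor2 i j x y \<noteq> 0"
proof -
  obtain S where S: "S \<subseteq> T" "vec.independent S" "T \<subseteq> vec.span S" "card S = vec.dim T"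
    using vec.basis_exists[of T] by blast
  obtain x y where xy: "S = {x, y}" "x \<noteq> y"
    using S(4) assms(2) by (metis card_2_iff)
  have "T = vec.span {x, y}"
    using S assms(1) xy(1) vec.span_minimal by blast
  moreover obtain i j where "minor2 i j x y \<noteq> 0"
    using S(2) xy independent_pair_iff by blast
  ultimately show ?thesis using that by blast
qed

lemma subspace_dim_3E:
  fixes B :: "('a::field ^ 'n::finite) set"
  assumes "vec.subspace B" and "vec.dim B = 3"
  obtains x y z i j where "B = vec.span {x, y, z}" and "minor2 i j x y \<noteq> 0" and "z \<notin> vec.span {x, y}"
proof -
  obtain S where S: "S \<subseteq> B" "vec.independent S" "B \<subseteq> vec.span S" "card S = vec.dim B"
    using vec.basis_exists[of B] by blast
  obtain x y z where xyz: "S = {x, y, z}"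
    using S(4) assms(2) by (metis card_3_iff)
  have "B = vec.span {x, y, z}"
    using S assms(1) xyz vec.span_minimal by blast
  moreover have "(\<exists>i j. minor2 i j x y \<noteq> 0) \<and> z \<notin> vec.span {x, y}"
    using S(2,4) assms(2) xyz independent_triple_iff by metis
  ultimately show ?thesis using that by blast
qed

section \<open>Reduction of alternating claims to increasing index tuples\<close>

lemma sorted_wlog_3:
  fixes P :: "'n::linorder \<Rightarrow> 'n \<Rightarrow> 'n \<Rightarrow> bool"
  assumes swap: "\<And>i j k. P i j k \<Longrightarrow> P j i k" "\<And>i j k. P i j k \<Longrightarrow> P i k j"
    and refl: "\<And>i k. P i i k" and sorted: "\<And>i j k. i < j \<Longrightarrow> j < k \<Longrightarrow> P i j k"
  shows "P i j k"
proof -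
  have *: "P i j k" if "i < j" for i j k
    by (metis that linorder_less_linear swap refl sorted)
  then show ?thesis
    by (metis linorder_less_linear swap refl)
qed

lemma sorted_wlog_4:
  fixes P :: "'n::linorder \<Rightarrow> 'n \<Rightarrow> 'n \<Rightarrow> 'n \<Rightarrow> bool"
  assumes swap: "\<And>i j k l. P i j k l \<Longrightarrow> P j i k l" "\<And>i j k l. P i j k l \<Longrightarrow> P i k j l"
      "\<And>i j k l. P i j k l \<Longrightarrow> P i j l k"
    and refl: "\<And>i k l. P i i k l" and sorted: "\<And>i j k l. i < j \<Longrightarrow> j < k \<Longrightarrow> k < l \<Longrightarrow> P i j k l"
  shows "P i j k l"
proof -
  have *: "P i j k l" if "i < j" "j < k" for i j k l
    by (metis that linorder_less_linear swap refl sorted)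
  show ?thesis
    by (rule sorted_wlog_3[where P = "\<lambda>i j k. P i j k l"]) (use swap refl * in blast)+
qed

lemma minor3_swap:
  "minor3 j i k x y z = - minor3 i j k x y z" "minor3 i k j x y z = - minor3 i j k x y z" "minor3 i i k x y z = 0"
  by (simp_all add: minor_defs algebra_simps)

lemma minor4_swap:
  "minor4 j i k l w x y z = - minor4 i j k l w x y z" "minor4 i k j l w x y z = - minor4 i j k l w x y z"
  "minor4 i j l k w x y z = - minor4 i j k l w x y z" "minor4 i i k l w x y z = 0"
  by (simp_all add: minor_defs algebra_simps)

lemma minor4_eq_0_swap:
  assumes "minor4 i j k l w x y z = 0"
  shows "minor4 j i k l w x y z = 0" "minor4 i k j l w x y z = 0" "minor4 i j l k w x y z = 0"
  using assms minor4_swap(1)[of j i k l w x y z] minor4_swap(2)[of i k j l w x y z] minor4_swap(3)[of i j l k w x y z]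
  by simp_all

lemma minor3_eq_0_swap:
  assumes "minor3 i j k x y z = 0"
  shows "minor3 j i k x y z = 0" "minor3 i k j x y z = 0"
  using assms minor3_swap(1)[of j i k x y z] minor3_swap(2)[of i k j x y z]
  by simp_all

lemma minor4_last:
  "minor4 i j k l x y z w =
     w $ l * minor3 i j k x y z - w $ k * minor3 i j l x y z + w $ j * minor3 i k l x y z - w $ i * minor3 j k l x y z"
  by (simp add: minor_defs algebra_simps)

text \<open>For dependent \<open>x\<close>, \<open>y\<close> the hypothesis is vacuous; expanding
  along \<open>z\<close> then writes the 3-minor through 2-minors of \<open>x\<close>,
  \<open>y\<close>, all zero.\<close>

lemma minor3_eq_0I:
  fixes x y z :: "'a::field ^ 'n::finite"
  assumes "\<And>i j. minor2 i j x y \<noteq> 0 \<Longrightarrow> z \<in> vec.span {x, y}"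
  shows "minor3 i j k x y z = 0"
proof (cases "\<exists>i j. minor2 i j x y \<noteq> 0")
  case True
  then obtain a b where "z = a *s x + b *s y"
    using assms in_span_pair_iff by blast
  then show ?thesis
    by (simp add: minor_defs algebra_simps)
next
  case False
  have "minor3 i j k x y z = z $ k * minor2 i j x y - z $ j * minor2 i k x y + z $ i * minor2 j k x y"
    by (simp add: minor_defs algebra_simps)
  then show ?thesis
    using False by simp
qed

section \<open>The index set of integers modulo 7\<close>

lemma UNIV_7: "(UNIV :: 7 set) = {0, 1, 2, 3, 4, 5, 6}"
proof -
  have "card {0, 1, 2, 3, 4, 5, 6 :: 7} = CARD(7)"
    by simp
  then show ?thesis
    by (intro card_subset_eq[symmetric]) auto
qed

lemma sum_7: "(\<Sum>n\<in>(UNIV :: 7 set). f n) = f 0 + f 1 + f 2 + f 3 + f 4 + f 5 + f 6"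
  unfolding UNIV_7 add.assoc by (subst sum.insert, simp, simp)+ simp

lemma forall_7: "(\<forall>n::7. P n) \<longleftrightarrow> P 0 \<and> P 1 \<and> P 2 \<and> P 3 \<and> P 4 \<and> P 5 \<and> P 6"
proof -
  have "(\<forall>n::7. P n) \<longleftrightarrow> (\<forall>n\<in>{0, 1, 2, 3, 4, 5, 6 :: 7}. P n)"
    by (simp only: flip: UNIV_7) simp
  then show ?thesis
    by simp
qed

lemma reduce_mod_7:
  "(7::7) = 0" "(8::7) = 1" "(9::7) = 2" "(10::7) = 3" "(11::7) = 4" "(12::7) = 5"
  by simp_all

lemmas less_7 = less_bit1_def bit1.Rep_numeral bit1.Rep_0 bit1.Rep_1

section \<open>The alternating form and the cross product\<close>

lemma fv_nth: "fv j $ i = (if i = j then 1 else 0)"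
  by (simp add: fv_def axis_def)

text \<open>The indices \<open>n + 2, n + 4, n + 5, n + 6\<close> are the points off the line \<open>n, n + 1, n + 3\<close>.\<close>

definition psi :: "(7 \<Rightarrow> 'a::comm_ring_1) \<Rightarrow> 'a ^ 7 \<Rightarrow> 'a ^ 7 \<Rightarrow> 'a ^ 7 \<Rightarrow> 'a ^ 7 \<Rightarrow> 'a" where
  "psi h w x y z = (\<Sum>n\<in>UNIV. h n * minor4 (n + 2) (n + 4) (n + 5) (n + 6) w x y z)"

lemma psi_expand:
  "psi h w x y z =
     h 0 * minor4 2 4 5 6 w x y z + h 1 * minor4 3 5 6 0 w x y z + h 2 * minor4 4 6 0 1 w x y z
   + h 3 * minor4 5 0 1 2 w x y z + h 4 * minor4 6 1 2 3 w x y z + h 5 * minor4 0 2 3 4 w x y z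
   + h 6 * minor4 1 3 4 5 w x y z"
  by (simp add: psi_def sum_7 reduce_mod_7)

text \<open>The weight of the component along the line through \<open>k\<close> is the product of the values of \<open>h\<close> on the
  other two lines through \<open>k\<close> (the lines through \<open>k\<close> are those with numbers \<open>k, k + 4, k + 6\<close>).  This
  makes all identities below polynomial in \<open>h\<close>, without normalizing \<open>h\<close> to 1.\<close>

definition cross :: "(7 \<Rightarrow> 'a::comm_ring_1) \<Rightarrow> 'a ^ 7 \<Rightarrow> 'a ^ 7 \<Rightarrow> 'a ^ 7" where
  "cross h x y = (\<chi> k. h (k + 4) * h (k + 6) * minor2 (k + 1) (k + 3) x y
      + h k * h (k + 4) * minor2 (k + 2) (k + 6) x y + h k * h (k + 6) * minor2 (k + 4) (k + 5) x y)"

lemma cross_nth: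
  "cross h x y $ 0 = h 4 * h 6 * minor2 1 3 x y + h 0 * h 4 * minor2 2 6 x y + h 0 * h 6 * minor2 4 5 x y"
  "cross h x y $ 1 = h 5 * h 0 * minor2 2 4 x y + h 1 * h 5 * minor2 3 0 x y + h 1 * h 0 * minor2 5 6 x y"
  "cross h x y $ 2 = h 6 * h 1 * minor2 3 5 x y + h 2 * h 6 * minor2 4 1 x y + h 2 * h 1 * minor2 6 0 x y"
  "cross h x y $ 3 = h 0 * h 2 * minor2 4 6 x y + h 3 * h 0 * minor2 5 2 x y + h 3 * h 2 * minor2 0 1 x y"
  "cross h x y $ 4 = h 1 * h 3 * minor2 5 0 x y + h 4 * h 1 * minor2 6 3 x y + h 4 * h 3 * minor2 1 2 x y"
  "cross h x y $ 5 = h 2 * h 4 * minor2 6 1 x y + h 5 * h 2 * minor2 0 4 x y + h 5 * h 4 * minor2 2 3 x y"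
  "cross h x y $ 6 = h 3 * h 5 * minor2 0 2 x y + h 6 * h 3 * minor2 1 5 x y + h 6 * h 5 * minor2 3 4 x y"
  by (simp_all add: cross_def reduce_mod_7)

lemma psi_last: "psi h x y z w = (\<Sum>i\<in>UNIV. w $ i * psi h x y z (fv i))"
  unfolding psi_expand minor4_last sum_7 fv_nth by (simp add: algebra_simps)

lemma psi_swap_last: "psi h x y z w = - psi h x y w z"
  unfolding psi_expand minor_defs by (simp add: algebra_simps)

lemma psi_rotate: "psi h w x y z = - psi h x y z w"
  unfolding psi_expand minor_defs by (simp add: algebra_simps)

lemma psi_repeat: "psi h x y z x = 0" "psi h x y z y = 0"
  "psi h x y z z = 0"
  unfolding psi_expand minor_defs by (simp_all add: algebra_simps)

lemma psi_eq_0I: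
  assumes "\<And>i j k. minor3 i j k x y z = 0"
  shows "psi h x y z w = 0"
  unfolding psi_expand minor4_last assms by simp

text \<open>As a function of its first three arguments \<open>psi\<close> is linear in their
  3-minors, which scale by the determinant of the coefficients. So vanishing on one spanning triple
  passes to the whole span.\<close>

lemma psi_combination:
  fixes x y z t :: "'a::field ^ 7"
  assumes "u = a1 *s x + a2 *s y + a3 *s z" "v = b1 *s x + b2 *s y + b3 *s z" "w = c1 *s x + c2 *s y + c3 *s z"
  shows "psi h u v w t =
    (a1 * (b2 * c3 - b3 * c2) - a2 * (b1 * c3 - b3 * c1) + a3 * (b1 * c2 - b2 * c1)) * psi h x y z t"
proof -
  have "minor3 i j k u v w =
    (a1 * (b2 * c3 - b3 * c2) - a2 * (b1 * c3 - b3 * c1) + a3 * (b1 * c2 - b2 * c1)) * minor3 i j k x y z" for i j k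
    unfolding minor_defs assms vector_add_component vector_smult_component by algebra
  then show ?thesis
    unfolding psi_expand minor4_last by (simp only: distrib_left right_diff_distrib mult.left_commute)
qed

text \<open>These are the entries of the skew matrix of the 2-form \<open>psi h x y\<close>. Each
  has two summands because exactly two Fano lines avoid two given points.\<close>

lemma psi_fv_fv:
  fixes x y :: "'a::field ^ 7"
  shows
  "psi h x y (fv 0) (fv 1) = h 2 * minor2 4 6 x y + h 3 * minor2 5 2 x y"
  "psi h x y (fv 0) (fv 2) = h 3 * minor2 1 5 x y + h 5 * minor2 3 4 x y"
  "psi h x y (fv 0) (fv 3) = h 1 * minor2 6 5 x y + h 5 * minor2 4 2 x y"
  "psi h x y (fv 0) (fv 4) = h 2 * minor2 6 1 x y + h 5 * minor2 2 3 x y"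
  "psi h x y (fv 0) (fv 5) = h 1 * minor2 3 6 x y + h 3 * minor2 2 1 x y"
  "psi h x y (fv 0) (fv 6) = h 1 * minor2 5 3 x y + h 2 * minor2 1 4 x y"
  "psi h x y (fv 1) (fv 2) = h 3 * minor2 5 0 x y + h 4 * minor2 6 3 x y"
  "psi h x y (fv 1) (fv 3) = h 4 * minor2 2 6 x y + h 6 * minor2 4 5 x y"
  "psi h x y (fv 1) (fv 4) = h 2 * minor2 0 6 x y + h 6 * minor2 5 3 x y"
  "psi h x y (fv 1) (fv 5) = h 3 * minor2 0 2 x y + h 6 * minor2 3 4 x y"
  "psi h x y (fv 1) (fv 6) = h 2 * minor2 4 0 x y + h 4 * minor2 3 2 x y"
  "psi h x y (fv 2) (fv 3) = h 4 * minor2 6 1 x y + h 5 * minor2 0 4 x y"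
  "psi h x y (fv 2) (fv 4) = h 0 * minor2 5 6 x y + h 5 * minor2 3 0 x y"
  "psi h x y (fv 2) (fv 5) = h 0 * minor2 6 4 x y + h 3 * minor2 1 0 x y"
  "psi h x y (fv 2) (fv 6) = h 0 * minor2 4 5 x y + h 4 * minor2 1 3 x y"
  "psi h x y (fv 3) (fv 4) = h 5 * minor2 0 2 x y + h 6 * minor2 1 5 x y"
  "psi h x y (fv 3) (fv 5) = h 1 * minor2 6 0 x y + h 6 * minor2 4 1 x y"
  "psi h x y (fv 3) (fv 6) = h 1 * minor2 0 5 x y + h 4 * minor2 2 1 x y"
  "psi h x y (fv 4) (fv 5) = h 0 * minor2 2 6 x y + h 6 * minor2 1 3 x y"
  "psi h x y (fv 4) (fv 6) = h 0 * minor2 5 2 x y + h 2 * minor2 0 1 x y"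
  "psi h x y (fv 5) (fv 6) = h 0 * minor2 2 4 x y + h 1 * minor2 3 0 x y"
  by (simp_all add: psi_expand minor_defs fv_nth)

lemma psi_fv:
  fixes x y z :: "'a::field ^ 7"
  shows
    "psi h x y z (fv 0) =
      h 1 * minor3 3 5 6 x y z - h 2 * minor3 1 4 6 x y z + h 3 * minor3 1 2 5 x y z - h 5 * minor3 2 3 4 x y z"
    "psi h x y z (fv 1) =
      h 2 * minor3 0 4 6 x y z - h 3 * minor3 0 2 5 x y z + h 4 * minor3 2 3 6 x y z - h 6 * minor3 3 4 5 x y z"
    "psi h x y z (fv 2) =
      - h 0 * minor3 4 5 6 x y z + h 3 * minor3 0 1 5 x y z - h 4 * minor3 1 3 6 x y z + h 5 * minor3 0 3 4 x y z"
    "psi h x y z (fv 3) =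
      - h 1 * minor3 0 5 6 x y z + h 4 * minor3 1 2 6 x y z - h 5 * minor3 0 2 4 x y z + h 6 * minor3 1 4 5 x y z"
    "psi h x y z (fv 4) =
      h 0 * minor3 2 5 6 x y z - h 2 * minor3 0 1 6 x y z + h 5 * minor3 0 2 3 x y z - h 6 * minor3 1 3 5 x y z"
    "psi h x y z (fv 5) =
      - h 0 * minor3 2 4 6 x y z + h 1 * minor3 0 3 6 x y z - h 3 * minor3 0 1 2 x y z + h 6 * minor3 1 3 4 x y z"
    "psi h x y z (fv 6) =
      h 0 * minor3 2 4 5 x y z - h 1 * minor3 0 3 5 x y z + h 2 * minor3 0 1 4 x y z - h 4 * minor3 1 2 3 x y z"
  by (simp_all add: psi_expand minor_defs fv_nth algebra_simps)

text \<open>The 4-by-4 Pfaffians of the skew matrix \<open>m\<close> are the 3-by-3 minors of \<open>x, y, c\<close> up to sign; here they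
  are expanded against a further vector \<open>z\<close>.\<close>

lemma minor4_cross:
  fixes x y z :: "'a::field ^ 7" and h :: "7 \<Rightarrow> 'a"
  defines "m \<equiv> \<lambda>i j. psi h x y (fv i) (fv j)" and "c \<equiv> cross h x y" and "r \<equiv> \<lambda>j. psi h x y z (fv j)"
  shows
    "minor4 3 4 5 6 x y c z = r 1 * m 0 2 - r 0 * m 1 2 - r 2 * m 0 1"
    "minor4 2 4 5 6 x y c z = r 0 * m 1 3 - r 1 * m 0 3 + r 3 * m 0 1"
    "minor4 2 3 5 6 x y c z = r 1 * m 0 4 - r 0 * m 1 4 - r 4 * m 0 1"
    "minor4 2 3 4 6 x y c z = r 0 * m 1 5 - r 1 * m 0 5 + r 5 * m 0 1"
    "minor4 2 3 4 5 x y c z = r 1 * m 0 6 - r 0 * m 1 6 - r 6 * m 0 1"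
    "minor4 1 4 5 6 x y c z = r 2 * m 0 3 - r 0 * m 2 3 - r 3 * m 0 2"
    "minor4 1 3 5 6 x y c z = r 0 * m 2 4 - r 2 * m 0 4 + r 4 * m 0 2"
    "minor4 1 3 4 6 x y c z = r 2 * m 0 5 - r 0 * m 2 5 - r 5 * m 0 2"
    "minor4 1 3 4 5 x y c z = r 0 * m 2 6 - r 2 * m 0 6 + r 6 * m 0 2"
    "minor4 1 2 5 6 x y c z = r 3 * m 0 4 - r 0 * m 3 4 - r 4 * m 0 3"
    "minor4 1 2 4 6 x y c z = r 0 * m 3 5 - r 3 * m 0 5 + r 5 * m 0 3"
    "minor4 1 2 4 5 x y c z = r 3 * m 0 6 - r 0 * m 3 6 - r 6 * m 0 3"
    "minor4 1 2 3 6 x y c z = r 4 * m 0 5 - r 0 * m 4 5 - r 5 * m 0 4"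
    "minor4 1 2 3 5 x y c z = r 0 * m 4 6 - r 4 * m 0 6 + r 6 * m 0 4"
    "minor4 1 2 3 4 x y c z = r 5 * m 0 6 - r 0 * m 5 6 - r 6 * m 0 5"
    "minor4 0 4 5 6 x y c z = r 1 * m 2 3 - r 2 * m 1 3 + r 3 * m 1 2"
    "minor4 0 3 5 6 x y c z = r 2 * m 1 4 - r 1 * m 2 4 - r 4 * m 1 2"
    "minor4 0 3 4 6 x y c z = r 1 * m 2 5 - r 2 * m 1 5 + r 5 * m 1 2"
    "minor4 0 3 4 5 x y c z = r 2 * m 1 6 - r 1 * m 2 6 - r 6 * m 1 2"
    "minor4 0 2 5 6 x y c z = r 1 * m 3 4 - r 3 * m 1 4 + r 4 * m 1 3"
    "minor4 0 2 4 6 x y c z = r 3 * m 1 5 - r 1 * m 3 5 - r 5 * m 1 3"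
    "minor4 0 2 4 5 x y c z = r 1 * m 3 6 - r 3 * m 1 6 + r 6 * m 1 3"
    "minor4 0 2 3 6 x y c z = r 1 * m 4 5 - r 4 * m 1 5 + r 5 * m 1 4"
    "minor4 0 2 3 5 x y c z = r 4 * m 1 6 - r 1 * m 4 6 - r 6 * m 1 4"
    "minor4 0 2 3 4 x y c z = r 1 * m 5 6 - r 5 * m 1 6 + r 6 * m 1 5"
    "minor4 0 1 5 6 x y c z = r 3 * m 2 4 - r 2 * m 3 4 - r 4 * m 2 3"
    "minor4 0 1 4 6 x y c z = r 2 * m 3 5 - r 3 * m 2 5 + r 5 * m 2 3"
    "minor4 0 1 4 5 x y c z = r 3 * m 2 6 - r 2 * m 3 6 - r 6 * m 2 3"
    "minor4 0 1 3 6 x y c z = r 4 * m 2 5 - r 2 * m 4 5 - r 5 * m 2 4"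
    "minor4 0 1 3 5 x y c z = r 2 * m 4 6 - r 4 * m 2 6 + r 6 * m 2 4"
    "minor4 0 1 3 4 x y c z = r 5 * m 2 6 - r 2 * m 5 6 - r 6 * m 2 5"
    "minor4 0 1 2 6 x y c z = r 3 * m 4 5 - r 4 * m 3 5 + r 5 * m 3 4"
    "minor4 0 1 2 5 x y c z = r 4 * m 3 6 - r 3 * m 4 6 - r 6 * m 3 4"
    "minor4 0 1 2 4 x y c z = r 3 * m 5 6 - r 5 * m 3 6 + r 6 * m 3 5"
    "minor4 0 1 2 3 x y c z = r 5 * m 4 6 - r 4 * m 5 6 - r 6 * m 4 5"
  unfolding m_def r_def psi_fv_fv unfolding psi_fv c_def minor_defs
  unfolding cross_nth unfolding minor2_def by algebra+

text \<open>Entry \<open>(i, j)\<close> of the symmetric tensor formed by the cyclic sum of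
  \<open>cross h x y\<close> times \<open>z\<close>. On the diagonal each term occurs twice;
  \<open>cross_diag\<close> evaluates half of that entry.\<close>

definition cross_sym :: "(7 \<Rightarrow> 'a::comm_ring_1) \<Rightarrow> 'a ^ 7 \<Rightarrow> 'a ^ 7 \<Rightarrow> 'a ^ 7 \<Rightarrow> 7 \<Rightarrow> 7 \<Rightarrow> 'a" where
  "cross_sym h x y z i j = cross h x y $ i * z $ j + cross h x y $ j * z $ i
     + cross h y z $ i * x $ j + cross h y z $ j * x $ i + cross h z x $ i * y $ j + cross h z x $ j * y $ i"

text \<open>The equations come in seven groups of three, one group for each point \<open>d\<close>,
  the pairs being those that complete \<open>d\<close> to a line. A group involves the same four
  minors as \<open>psi h x y z (fv d)\<close> in \<open>psi_fv\<close>, with other signs.\<close>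

lemma cross_sym_offdiag:
  fixes x y z :: "'a::field ^ 7"
  shows
    "cross_sym h x y z 1 3 =
      h 0 * (- h 3 * minor3 1 2 5 x y z + h 2 * minor3 1 4 6 x y z - h 5 * minor3 2 3 4 x y z + h 1 * minor3 3 5 6 x y z)"
    "cross_sym h x y z 2 6 =
      h 6 * (- h 3 * minor3 1 2 5 x y z - h 2 * minor3 1 4 6 x y z + h 5 * minor3 2 3 4 x y z + h 1 * minor3 3 5 6 x y z)"
    "cross_sym h x y z 4 5 =
      h 4 * (h 3 * minor3 1 2 5 x y z + h 2 * minor3 1 4 6 x y z + h 5 * minor3 2 3 4 x y z + h 1 * minor3 3 5 6 x y z)"
    "cross_sym h x y z 2 4 =
      h 1 * (h 3 * minor3 0 2 5 x y z + h 2 * minor3 0 4 6 x y z - h 4 * minor3 2 3 6 x y z - h 6 * minor3 3 4 5 x y z)"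
    "cross_sym h x y z 0 3 =
      h 0 * (- h 3 * minor3 0 2 5 x y z + h 2 * minor3 0 4 6 x y z - h 4 * minor3 2 3 6 x y z + h 6 * minor3 3 4 5 x y z)"
    "cross_sym h x y z 5 6 =
      h 5 * (h 3 * minor3 0 2 5 x y z + h 2 * minor3 0 4 6 x y z + h 4 * minor3 2 3 6 x y z + h 6 * minor3 3 4 5 x y z)"
    "cross_sym h x y z 3 5 =
      h 2 * (h 3 * minor3 0 1 5 x y z - h 5 * minor3 0 3 4 x y z + h 4 * minor3 1 3 6 x y z - h 0 * minor3 4 5 6 x y z)"
    "cross_sym h x y z 1 4 =
      h 1 * (h 3 * minor3 0 1 5 x y z - h 5 * minor3 0 3 4 x y z - h 4 * minor3 1 3 6 x y z + h 0 * minor3 4 5 6 x y z)"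
    "cross_sym h x y z 0 6 =
      h 6 * (h 3 * minor3 0 1 5 x y z + h 5 * minor3 0 3 4 x y z + h 4 * minor3 1 3 6 x y z + h 0 * minor3 4 5 6 x y z)"
    "cross_sym h x y z 4 6 =
      h 3 * (h 5 * minor3 0 2 4 x y z - h 1 * minor3 0 5 6 x y z + h 4 * minor3 1 2 6 x y z - h 6 * minor3 1 4 5 x y z)"
    "cross_sym h x y z 2 5 =
      h 2 * (- h 5 * minor3 0 2 4 x y z + h 1 * minor3 0 5 6 x y z + h 4 * minor3 1 2 6 x y z - h 6 * minor3 1 4 5 x y z)"
    "cross_sym h x y z 0 1 =
      h 0 * (h 5 * minor3 0 2 4 x y z + h 1 * minor3 0 5 6 x y z + h 4 * minor3 1 2 6 x y z + h 6 * minor3 1 4 5 x y z)"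
    "cross_sym h x y z 0 5 =
      h 4 * (- h 2 * minor3 0 1 6 x y z + h 5 * minor3 0 2 3 x y z + h 6 * minor3 1 3 5 x y z - h 0 * minor3 2 5 6 x y z)"
    "cross_sym h x y z 3 6 =
      h 3 * (h 2 * minor3 0 1 6 x y z + h 5 * minor3 0 2 3 x y z - h 6 * minor3 1 3 5 x y z - h 0 * minor3 2 5 6 x y z)"
    "cross_sym h x y z 1 2 =
      h 1 * (h 2 * minor3 0 1 6 x y z + h 5 * minor3 0 2 3 x y z + h 6 * minor3 1 3 5 x y z + h 0 * minor3 2 5 6 x y z)"
    "cross_sym h x y z 1 6 =
      h 5 * (- h 3 * minor3 0 1 2 x y z - h 1 * minor3 0 3 6 x y z + h 6 * minor3 1 3 4 x y z + h 0 * minor3 2 4 6 x y z)"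
    "cross_sym h x y z 0 4 =
      h 4 * (h 3 * minor3 0 1 2 x y z - h 1 * minor3 0 3 6 x y z + h 6 * minor3 1 3 4 x y z - h 0 * minor3 2 4 6 x y z)"
    "cross_sym h x y z 2 3 =
      h 2 * (h 3 * minor3 0 1 2 x y z + h 1 * minor3 0 3 6 x y z + h 6 * minor3 1 3 4 x y z + h 0 * minor3 2 4 6 x y z)"
    "cross_sym h x y z 0 2 =
      h 6 * (- h 2 * minor3 0 1 4 x y z + h 1 * minor3 0 3 5 x y z - h 4 * minor3 1 2 3 x y z + h 0 * minor3 2 4 5 x y z)"
    "cross_sym h x y z 1 5 =
      h 5 * (- h 2 * minor3 0 1 4 x y z - h 1 * minor3 0 3 5 x y z + h 4 * minor3 1 2 3 x y z + h 0 * minor3 2 4 5 x y z)"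
    "cross_sym h x y z 3 4 =
      h 3 * (h 2 * minor3 0 1 4 x y z + h 1 * minor3 0 3 5 x y z + h 4 * minor3 1 2 3 x y z + h 0 * minor3 2 4 5 x y z)"
  unfolding cross_sym_def cross_nth minor_defs by algebra+

text \<open>At the point \<open>k\<close> only the minors on the three lines through
  \<open>k\<close> survive.\<close>

lemma cross_diag:
  fixes x y z :: "'a::field ^ 7"
  shows
    "cross h x y $ 0 * z $ 0 + cross h y z $ 0 * x $ 0 + cross h z x $ 0 * y $ 0 =
     h 6 * h 4 * minor3 0 1 3 x y z + h 0 * h 4 * minor3 0 2 6 x y z + h 0 * h 6 * minor3 0 4 5 x y z"
    "cross h x y $ 1 * z $ 1 + cross h y z $ 1 * x $ 1 + cross h z x $ 1 * y $ 1 =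
     h 0 * h 5 * minor3 1 2 4 x y z + h 1 * h 5 * minor3 0 1 3 x y z + h 1 * h 0 * minor3 1 5 6 x y z"
    "cross h x y $ 2 * z $ 2 + cross h y z $ 2 * x $ 2 + cross h z x $ 2 * y $ 2 =
     h 1 * h 6 * minor3 2 3 5 x y z + h 2 * h 6 * minor3 1 2 4 x y z + h 2 * h 1 * minor3 0 2 6 x y z"
    "cross h x y $ 3 * z $ 3 + cross h y z $ 3 * x $ 3 + cross h z x $ 3 * y $ 3 =
     h 2 * h 0 * minor3 3 4 6 x y z + h 3 * h 0 * minor3 2 3 5 x y z + h 3 * h 2 * minor3 0 1 3 x y z"
    "cross h x y $ 4 * z $ 4 + cross h y z $ 4 * x $ 4 + cross h z x $ 4 * y $ 4 =
     h 3 * h 1 * minor3 0 4 5 x y z + h 4 * h 1 * minor3 3 4 6 x y z + h 4 * h 3 * minor3 1 2 4 x y z"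
    "cross h x y $ 5 * z $ 5 + cross h y z $ 5 * x $ 5 + cross h z x $ 5 * y $ 5 =
     h 4 * h 2 * minor3 1 5 6 x y z + h 5 * h 2 * minor3 0 4 5 x y z + h 5 * h 4 * minor3 2 3 5 x y z"
    "cross h x y $ 6 * z $ 6 + cross h y z $ 6 * x $ 6 + cross h z x $ 6 * y $ 6 =
     h 5 * h 3 * minor3 0 2 6 x y z + h 6 * h 3 * minor3 1 5 6 x y z + h 6 * h 5 * minor3 3 4 6 x y z"
  unfolding cross_nth minor_defs by algebra+

text \<open>The coefficient at \<open>i\<close> is the product of \<open>h\<close> over the four lines off the point \<open>i\<close>.\<close>

definition polar :: "(7 \<Rightarrow> 'a::comm_ring_1) \<Rightarrow> 'a ^ 7 \<Rightarrow> 'a ^ 7 \<Rightarrow> 'a" where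
  "polar h x y = (\<Sum>i\<in>UNIV. h (i + 1) * h (i + 2) * h (i + 3) * h (i + 5) * x $ i * y $ i)"

text \<open>A rescaled form of left alternativity of the octonions, restricted to imaginary
  elements; \<open>polar h x x\<close> plays the role of the norm.\<close>

lemma cross_cross:
  fixes x y :: "'a::field ^ 7"
  shows "cross h x (cross h x y) = polar h x y *s x - polar h x x *s y"
proof -
  have polar: "polar h x v = h 1 * h 2 * h 3 * h 5 * x $ 0 * v $ 0 + h 2 * h 3 * h 4 * h 6 * x $ 1 * v $ 1
    + h 3 * h 4 * h 5 * h 0 * x $ 2 * v $ 2 + h 4 * h 5 * h 6 * h 1 * x $ 3 * v $ 3
    + h 5 * h 6 * h 0 * h 2 * x $ 4 * v $ 4 + h 6 * h 0 * h 1 * h 3 * x $ 5 * v $ 5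
    + h 0 * h 1 * h 2 * h 4 * x $ 6 * v $ 6" for v
    by (simp add: polar_def sum_7 reduce_mod_7)
  show ?thesis
    unfolding vec_eq_iff forall_7 vector_minus_component vector_smult_component cross_nth(1-7)[of h x "cross h x y"] polar
    unfolding minor2_def cross_nth unfolding minor2_def by (intro conjI; algebra)
qed

section \<open>Evaluating the determinants\<close>

text \<open>A 4-form that sees only the coordinates \<open>i\<close>, \<open>j\<close>,
  \<open>k\<close>, \<open>l\<close> is a multiple of the minor on them: in the multilinear
  expansion only permutations of \<open>e1\<close>, \<open>e2\<close>, \<open>e3\<close>,
  \<open>e4\<close> survive, each contributing its sign.\<close>

lemma alternating4_expansion:
  fixes D :: "'a::comm_ring_1 ^ 'n::finite \<Rightarrow> 'a ^ 'n \<Rightarrow> 'a ^ 'n \<Rightarrow> 'a ^ 'n \<Rightarrow> 'a"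
  assumes lin:
      "\<And>w x y z. D w x y z = w $ i * D e1 x y z + w $ j * D e2 x y z + w $ k * D e3 x y z + w $ l * D e4 x y z"
      "\<And>w x y z. D w x y z = x $ i * D w e1 y z + x $ j * D w e2 y z + x $ k * D w e3 y z + x $ l * D w e4 y z"
      "\<And>w x y z. D w x y z = y $ i * D w x e1 z + y $ j * D w x e2 z + y $ k * D w x e3 z + y $ l * D w x e4 z"
      "\<And>w x y z. D w x y z = z $ i * D w x y e1 + z $ j * D w x y e2 + z $ k * D w x y e3 + z $ l * D w x y e4"
    and alt: "\<And>w y z. D w w y z = 0" "\<And>w x z. D w x x z = 0" "\<And>w x y. D w x y y = 0"
      "\<And>w x y. D w x w y = 0" "\<And>w x y. D w x y w = 0" "\<And>w x y. D w x y x = 0"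
    and swap: "\<And>w x y z. D x w y z = - D w x y z" "\<And>w x y z. D w y x z = - D w x y z"
      "\<And>w x y z. D w x z y = - D w x y z"
  shows "D w x y z = minor4 i j k l w x y z * D e1 e2 e3 e4"
proof -
  \<comment> \<open>Each instance exchanges two neighbours that are out of order, so rewriting sorts
    every surviving term into \<open>D e1 e2 e3 e4\<close>.\<close>
  note sort1 = swap(1)[of e2 e1] swap(1)[of e3 e1] swap(1)[of e4 e1]
      swap(1)[of e3 e2] swap(1)[of e4 e2] swap(1)[of e4 e3]
  note sort2 = swap(2)[of _ e2 e1] swap(2)[of _ e3 e1] swap(2)[of _ e4 e1]
      swap(2)[of _ e3 e2] swap(2)[of _ e4 e2] swap(2)[of _ e4 e3]
  note sort3 = swap(3)[of _ _ e2 e1] swap(3)[of _ _ e3 e1] swap(3)[of _ _ e4 e1]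
      swap(3)[of _ _ e3 e2] swap(3)[of _ _ e4 e2] swap(3)[of _ _ e4 e3]
  show ?thesis
    unfolding lin(1)[of w x y z] unfolding lin(2)[of _ x y z] unfolding lin(3)[of _ _ y z] unfolding lin(4)[of _ _ _ z]
    by (simp add: alt sort1 sort2 sort3) (simp add: minor_defs algebra_simps)
qed

lemma det_row_expansion:
  fixes x :: "'a::comm_ring_1 ^ 'n::finite"
  shows "det (\<chi> i. if i = k then x else c i) = (\<Sum>j\<in>UNIV. x $ j * det (\<chi> i. if i = k then axis j 1 else c i))"
proof -
  have "det (\<chi> i. if i = k then x else c i) = det (\<chi> i. if i = k then \<Sum>j\<in>UNIV. x $ j *s axis j 1 else c i)"
    by (simp only: basis_expansion)
  also have "\<dots> = (\<Sum>j\<in>UNIV. det (\<chi> i. if i = k then x $ j *s axis j 1 else c i))"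
    by (rule det_linear_row_sum) simp
  also have "\<dots> = (\<Sum>j\<in>UNIV. x $ j * det (\<chi> i. if i = k then axis j 1 else c i))"
    by (simp only: det_row_mul)
  finally show ?thesis .
qed

text \<open>Only slots 0, 4, 5 and 6 are expanded; slots 1 to 3 are going to hold the points of a
  line.\<close>

lemma wedge7_expand:
  "wedge7 x0 x1 x2 x3 x4 x5 x6 = (\<Sum>j\<in>UNIV. x0 $ j * wedge7 (fv j) x1 x2 x3 x4 x5 x6)"
  "wedge7 x0 x1 x2 x3 x4 x5 x6 = (\<Sum>j\<in>UNIV. x4 $ j * wedge7 x0 x1 x2 x3 (fv j) x5 x6)"
  "wedge7 x0 x1 x2 x3 x4 x5 x6 = (\<Sum>j\<in>UNIV. x5 $ j * wedge7 x0 x1 x2 x3 x4 (fv j) x6)"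
  "wedge7 x0 x1 x2 x3 x4 x5 x6 = (\<Sum>j\<in>UNIV. x6 $ j * wedge7 x0 x1 x2 x3 x4 x5 (fv j))"
proof -
  define c where "c = (\<lambda>i::7. if i = 0 then x0 else if i = 1 then x1 else if i = 2 then x2 else
     if i = 3 then x3 else if i = 4 then x4 else if i = 5 then x5 else x6)"
  have row: "(\<chi> i. if i = 0 then x else c i) = (\<chi> i. if i = 0 then x else if i = 1 then x1 else if i = 2 then x2 else
     if i = 3 then x3 else if i = 4 then x4 else if i = 5 then x5 else x6)"
    "(\<chi> i. if i = 4 then x else c i) = (\<chi> i. if i = 0 then x0 else if i = 1 then x1 else if i = 2 then x2 else
     if i = 3 then x3 else if i = 4 then x else if i = 5 then x5 else x6)"
    "(\<chi> i. if i = 5 then x else c i) = (\<chi> i. if i = 0 then x0 else if i = 1 then x1 else if i = 2 then x2 else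
     if i = 3 then x3 else if i = 4 then x4 else if i = 5 then x else x6)"
    "(\<chi> i. if i = 6 then x else c i) = (\<chi> i. if i = 0 then x0 else if i = 1 then x1 else if i = 2 then x2 else
     if i = 3 then x3 else if i = 4 then x4 else if i = 5 then x5 else x)" for x
    by (simp_all add: vec_eq_iff forall_7 c_def)
  show "wedge7 x0 x1 x2 x3 x4 x5 x6 = (\<Sum>j\<in>UNIV. x0 $ j * wedge7 (fv j) x1 x2 x3 x4 x5 x6)"
    using det_row_expansion[of 0 x0 c] unfolding wedge7_def fv_def row .
  show "wedge7 x0 x1 x2 x3 x4 x5 x6 = (\<Sum>j\<in>UNIV. x4 $ j * wedge7 x0 x1 x2 x3 (fv j) x5 x6)"
    using det_row_expansion[of 4 x4 c] unfolding wedge7_def fv_def row .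
  show "wedge7 x0 x1 x2 x3 x4 x5 x6 = (\<Sum>j\<in>UNIV. x5 $ j * wedge7 x0 x1 x2 x3 x4 (fv j) x6)"
    using det_row_expansion[of 5 x5 c] unfolding wedge7_def fv_def row .
  show "wedge7 x0 x1 x2 x3 x4 x5 x6 = (\<Sum>j\<in>UNIV. x6 $ j * wedge7 x0 x1 x2 x3 x4 x5 (fv j))"
    using det_row_expansion[of 6 x6 c] unfolding wedge7_def fv_def row .
qed

lemma wedge7_repeat:
  "wedge7 x x x2 x3 x4 x5 x6 = 0" "wedge7 x x1 x x3 x4 x5 x6 = 0" "wedge7 x x1 x2 x x4 x5 x6 = 0"
  "wedge7 x x1 x2 x3 x x5 x6 = 0" "wedge7 x x1 x2 x3 x4 x x6 = 0" "wedge7 x x1 x2 x3 x4 x5 x = 0"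
  "wedge7 x0 x x2 x3 x x5 x6 = 0" "wedge7 x0 x x2 x3 x4 x x6 = 0" "wedge7 x0 x x2 x3 x4 x5 x = 0"
  "wedge7 x0 x1 x x3 x x5 x6 = 0" "wedge7 x0 x1 x x3 x4 x x6 = 0" "wedge7 x0 x1 x x3 x4 x5 x = 0"
  "wedge7 x0 x1 x2 x x x5 x6 = 0" "wedge7 x0 x1 x2 x x4 x x6 = 0" "wedge7 x0 x1 x2 x x4 x5 x = 0"
  "wedge7 x0 x1 x2 x3 x x x6 = 0" "wedge7 x0 x1 x2 x3 x x5 x = 0" "wedge7 x0 x1 x2 x3 x4 x x = 0"
  unfolding wedge7_def
  by (rule det_identical_rows[of 0 1] det_identical_rows[of 0 2] det_identical_rows[of 0 3]
      det_identical_rows[of 0 4] det_identical_rows[of 0 5] det_identical_rows[of 0 6]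
      det_identical_rows[of 1 4] det_identical_rows[of 1 5] det_identical_rows[of 1 6]
      det_identical_rows[of 2 4] det_identical_rows[of 2 5] det_identical_rows[of 2 6]
      det_identical_rows[of 3 4] det_identical_rows[of 3 5] det_identical_rows[of 3 6]
      det_identical_rows[of 4 5] det_identical_rows[of 4 6] det_identical_rows[of 5 6];
      simp add: row_def vec_eq_iff; fail)+

lemma det_swap_rows:
  fixes A :: "'a::comm_ring_1 ^ 'n ^ 'n::finite"
  assumes "i \<noteq> j"
  shows "det (\<chi> k. A $ Transposition.transpose i j k) = - det A"
  using det_permute_rows[of "Transposition.transpose i j" A] assms
  by (simp add: sign_swap_id permutes_swap_id)

text \<open>The first three transpositions are the neighbours among the free slots 0, 4, 5, 6. The
  fourth exchanges two points of the line and accounts for the two orientations.\<close>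

lemma wedge7_swap:
  "wedge7 x4 x1 x2 x3 x0 x5 x6 = - wedge7 x0 x1 x2 x3 x4 x5 x6"
  "wedge7 x0 x1 x2 x3 x5 x4 x6 = - wedge7 x0 x1 x2 x3 x4 x5 x6"
  "wedge7 x0 x1 x2 x3 x4 x6 x5 = - wedge7 x0 x1 x2 x3 x4 x5 x6"
  "wedge7 x0 x2 x1 x3 x4 x5 x6 = - wedge7 x0 x1 x2 x3 x4 x5 x6"
  unfolding wedge7_def
  by (subst det_swap_rows[of 0 4, symmetric] det_swap_rows[of 4 5, symmetric]
        det_swap_rows[of 5 6, symmetric] det_swap_rows[of 1 2, symmetric];
      simp; intro arg_cong[where f = det]; simp add: vec_eq_iff forall_7 Transposition.transpose_def; fail)+

lemma sum_7_shift:
  "(\<Sum>j\<in>(UNIV :: 7 set). f j) = f n + f (n + 1) + f (n + 2) + f (n + 3) + f (n + 4) + f (n + 5) + f (n + 6)"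
proof -
  have "(\<Sum>j\<in>UNIV. f j) = (\<Sum>j\<in>UNIV. f (n + j))"
    by (rule sum.reindex_bij_witness[of _ "\<lambda>j. n + j" "\<lambda>j. j - n"]) auto
  then show ?thesis
    by (simp add: sum_7)
qed

text \<open>The matrix is a permutation matrix, for the 3-cycle \<open>c\<close> of the first three
  positions followed by translation by \<open>n\<close>; both are even.\<close>

lemma wedge7_axes:
  "wedge7 (fv (n + 2)) (fv n) (fv (n + 1)) (fv (n + 3)) (fv (n + 4)) (fv (n + 5)) (fv (n + 6)) = 1"
proof -
  define c where "c = (\<lambda>i::7. if i = 0 then 2 else if i = 1 then 0 else if i = 2 then 1 else i)"
  define d where "d = (\<lambda>i::7. if i = 0 then 1 else if i = 1 then 2 else if i = 2 then 0 else i)"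
  have bij: "bij c" "bij d" "bij (\<lambda>i. m + i)" for m :: 7
    by (rule o_bij[of d] o_bij[of c] o_bij[of "\<lambda>i. i - m"]; simp add: c_def d_def fun_eq_iff; fail)+
  have "c = d \<circ> d"
    by (simp add: c_def d_def fun_eq_iff)
  then have sign_c: "sign c = 1"
    using sign_compose[of d d] bij by (simp add: permutation)
  \<comment> \<open>Since 8 = 1 modulo 7, \<open>4 * n\<close> is half of \<open>n\<close>.\<close>
  have "(\<lambda>i. n + i) = (\<lambda>i. 4 * n + i) \<circ> (\<lambda>i. 4 * n + i)"
  proof
    have "4 * n + 4 * n = n"
      by (simp add: reduce_mod_7 flip: distrib_right)
    then show "n + i = ((\<lambda>i. 4 * n + i) \<circ> (\<lambda>i. 4 * n + i)) i" for i
      by (simp flip: add.assoc)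
  qed
  then have "sign (\<lambda>i. n + i) = sign (\<lambda>i. 4 * n + i) * sign (\<lambda>i. 4 * n + i)"
    using sign_compose[of "\<lambda>i. 4 * n + i" "\<lambda>i. 4 * n + i"] bij by (simp only: permutation finite simp_thms)
  then have sign_s: "sign (\<lambda>i. n + i) = 1"
    by simp
  define p where "p = (\<lambda>i. n + i) \<circ> c"
  \<comment> \<open>Both factors of \<open>p\<close> are squares of permutations, hence even.\<close>
  have "sign p = 1"
    using sign_compose[of "\<lambda>i. n + i" c] bij by (simp add: p_def permutation sign_c sign_s)
  moreover have "bij p"
    unfolding p_def using bij by (intro bij_comp)
  then have "p permutes UNIV"
    by (intro bij_imp_permutes) simp_all
  ultimately have "det (\<chi> i. mat 1 $ p i :: 'a ^ 7 ^ 7) = 1"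
    using det_permute_rows[of p "mat 1 :: 'a ^ 7 ^ 7"] by simp
  moreover have "(\<chi> i. mat 1 $ p i :: 'a ^ 7 ^ 7) = (\<chi> i. if i = 0 then fv (n + 2) else if i = 1 then fv n else
      if i = 2 then fv (n + 1) else if i = 3 then fv (n + 3) else if i = 4 then fv (n + 4) else
      if i = 5 then fv (n + 5) else fv (n + 6))"
    by (subst vec_eq_iff, subst forall_7) (simp add: p_def c_def mat_def fv_def axis_def vec_eq_iff eq_commute)
  ultimately show ?thesis
    by (simp add: wedge7_def)
qed

text \<open>Components along the three points of the line repeat a row and drop out, so the
  determinant is an alternating form in the other four coordinates; \<open>wedge7_axes\<close> fixes
  the factor.\<close>

lemma wedge7_line:
  "wedge7 w (fv n) (fv (n + 1)) (fv (n + 3)) x y z = minor4 (n + 2) (n + 4) (n + 5) (n + 6) w x y z"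
proof -
  have "wedge7 w (fv n) (fv (n + 1)) (fv (n + 3)) x y z = minor4 (n + 2) (n + 4) (n + 5) (n + 6) w x y z *
      wedge7 (fv (n + 2)) (fv n) (fv (n + 1)) (fv (n + 3)) (fv (n + 4)) (fv (n + 5)) (fv (n + 6))"
  proof (rule alternating4_expansion[where D = "\<lambda>w x y z. wedge7 w (fv n) (fv (n + 1)) (fv (n + 3)) x y z"])
    fix w x y z :: "'a ^ 7"
    note expand = wedge7_expand[of w "fv n" "fv (n + 1)" "fv (n + 3)" x y z, unfolded sum_7_shift[of _ n] wedge7_repeat
      mult_zero_right add_0_left add_0_right]
    show "wedge7 w (fv n) (fv (n + 1)) (fv (n + 3)) x y z =
        w $ (n + 2) * wedge7 (fv (n + 2)) (fv n) (fv (n + 1)) (fv (n + 3)) x y z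
      + w $ (n + 4) * wedge7 (fv (n + 4)) (fv n) (fv (n + 1)) (fv (n + 3)) x y z
      + w $ (n + 5) * wedge7 (fv (n + 5)) (fv n) (fv (n + 1)) (fv (n + 3)) x y z
      + w $ (n + 6) * wedge7 (fv (n + 6)) (fv n) (fv (n + 1)) (fv (n + 3)) x y z"
      by (rule expand(1))
    show "wedge7 w (fv n) (fv (n + 1)) (fv (n + 3)) x y z =
        x $ (n + 2) * wedge7 w (fv n) (fv (n + 1)) (fv (n + 3)) (fv (n + 2)) y z
      + x $ (n + 4) * wedge7 w (fv n) (fv (n + 1)) (fv (n + 3)) (fv (n + 4)) y z
      + x $ (n + 5) * wedge7 w (fv n) (fv (n + 1)) (fv (n + 3)) (fv (n + 5)) y z
      + x $ (n + 6) * wedge7 w (fv n) (fv (n + 1)) (fv (n + 3)) (fv (n + 6)) y z"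
      by (rule expand(2))
    show "wedge7 w (fv n) (fv (n + 1)) (fv (n + 3)) x y z =
        y $ (n + 2) * wedge7 w (fv n) (fv (n + 1)) (fv (n + 3)) x (fv (n + 2)) z
      + y $ (n + 4) * wedge7 w (fv n) (fv (n + 1)) (fv (n + 3)) x (fv (n + 4)) z
      + y $ (n + 5) * wedge7 w (fv n) (fv (n + 1)) (fv (n + 3)) x (fv (n + 5)) z
      + y $ (n + 6) * wedge7 w (fv n) (fv (n + 1)) (fv (n + 3)) x (fv (n + 6)) z"
      by (rule expand(3))
    show "wedge7 w (fv n) (fv (n + 1)) (fv (n + 3)) x y z =
        z $ (n + 2) * wedge7 w (fv n) (fv (n + 1)) (fv (n + 3)) x y (fv (n + 2))
      + z $ (n + 4) * wedge7 w (fv n) (fv (n + 1)) (fv (n + 3)) x y (fv (n + 4))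
      + z $ (n + 5) * wedge7 w (fv n) (fv (n + 1)) (fv (n + 3)) x y (fv (n + 5))
      + z $ (n + 6) * wedge7 w (fv n) (fv (n + 1)) (fv (n + 3)) x y (fv (n + 6))"
      by (rule expand(4))
  qed (rule wedge7_repeat wedge7_swap)+
  then show ?thesis
    by (simp add: wedge7_axes)
qed

text \<open>Reversing all cyclic orders changes one global sign, so both orientations give the same
  blocks.\<close>

lemma eta_eq_psi:
  "eta eps \<alpha> \<beta> \<gamma> j x y z = (if eps = 0 then 1 else - 1) * psi (hval \<alpha> \<beta> \<gamma>) (fv j) x y z"
proof -
  have "wedge7 w (fv (n + 1)) (fv n) (fv (n + 3)) x y z = - minor4 (n + 2) (n + 4) (n + 5) (n + 6) w x y z" for w n
    using wedge7_swap(4)[of w "fv (n + 1)" "fv n"] by (simp only: wedge7_line)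
  then show ?thesis
    by (simp add: eta_def psi_def line_pts_def wedge7_line sum_negf)
qed

section \<open>Blocks\<close>

lemma eta_eq_0_iff:
  "eta eps \<alpha> \<beta> \<gamma> j x y z = 0 \<longleftrightarrow> psi (hval \<alpha> \<beta> \<gamma>) x y z (fv j) = 0"
  using psi_rotate[of "hval \<alpha> \<beta> \<gamma>" "fv j" x y z] by (simp add: eta_eq_psi)

text \<open>The passage from bases of \<open>B\<close> to arbitrary triples in \<open>B\<close>
  works because dependent triples have only zero 3-minors, on which \<open>psi\<close>
  depends.\<close>

lemma frakB_iff:
  "B \<in> frakB eps \<alpha> \<beta> \<gamma> \<longleftrightarrow> vec.subspace B \<and> vec.dim B = 3 \<and>
    (\<forall>x\<in>B. \<forall>y\<in>B. \<forall>z\<in>B. \<forall>j. psi (hval \<alpha> \<beta> \<gamma>) x y z (fv j) = 0)"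
proof
  assume B: "B \<in> frakB eps \<alpha> \<beta> \<gamma>"
  then have dim: "vec.subspace B" "vec.dim B = 3"
    by (auto simp: frakB_def)
  have "psi (hval \<alpha> \<beta> \<gamma>) x y z (fv j) = 0" if xyz: "x \<in> B" "y \<in> B" "z \<in> B" for x y z j
  proof (cases "(\<exists>i j. minor2 i j x y \<noteq> 0) \<and> z \<notin> vec.span {x, y}")
    case True
    then have ind: "vec.independent {x, y, z}" "card {x, y, z} = 3"
      unfolding independent_triple_iff[symmetric] by blast+
    have "B \<subseteq> vec.span {x, y, z}"
      using ind xyz dim(2) by (intro vec.card_ge_dim_independent) auto
    then have "vec.span {x, y, z} = B"
      using xyz dim(1) by (metis empty_subsetI insert_subset subset_antisym vec.span_minimal)
    then show ?thesis
      using B ind unfolding frakB_def eta_eq_0_iff by blast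
  next
    case False
    then show ?thesis
      by (intro psi_eq_0I minor3_eq_0I) blast
  qed
  then show "vec.subspace B \<and> vec.dim B = 3 \<and>
    (\<forall>x\<in>B. \<forall>y\<in>B. \<forall>z\<in>B. \<forall>j. psi (hval \<alpha> \<beta> \<gamma>) x y z (fv j) = 0)"
    using dim by blast
next
  assume B: "vec.subspace B \<and> vec.dim B = 3 \<and>
    (\<forall>x\<in>B. \<forall>y\<in>B. \<forall>z\<in>B. \<forall>j. psi (hval \<alpha> \<beta> \<gamma>) x y z (fv j) = 0)"
  have "eta eps \<alpha> \<beta> \<gamma> j x y z = 0" if "vec.span {x, y, z} = B" for x y z j
    using that B unfolding eta_eq_0_iff by (metis insertCI vec.span_base)
  then show "B \<in> frakB eps \<alpha> \<beta> \<gamma>"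
    using B unfolding frakB_def by blast
qed

lemma span_triple_in_frakB:
  assumes "minor2 i j x y \<noteq> 0" and "z \<notin> vec.span {x, y}"
    and "\<And>j. psi (hval \<alpha> \<beta> \<gamma>) x y z (fv j) = 0"
  shows "vec.span {x, y, z} \<in> frakB eps \<alpha> \<beta> \<gamma>"
  unfolding frakB_iff
proof (intro conjI ballI allI)
  show "vec.dim (vec.span {x, y, z}) = 3"
    using assms(1,2) by (rule dim_span_triple)
next
  fix u v w j assume "u \<in> vec.span {x, y, z}" "v \<in> vec.span {x, y, z}" "w \<in> vec.span {x, y, z}"
  then show "psi (hval \<alpha> \<beta> \<gamma>) u v w (fv j) = 0"
    unfolding in_span_triple_iff by (elim exE) (simp only: psi_combination assms(3) mult_zero_right)
qed (rule vec.subspace_span)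

text \<open>By \<open>minor4_cross\<close> every 4-minor of \<open>x\<close>, \<open>y\<close>,
  \<open>cross h x y\<close>, \<open>z\<close> is a combination of the values
  \<open>psi h x y z (fv j)\<close> and hence zero, while some 3-minor of the first three vectors is
  not.\<close>

lemma cross_kernel:
  fixes x y z :: "'a::field ^ 7"
  assumes ij: "minor2 i j x y \<noteq> 0" and c: "cross h x y \<notin> vec.span {x, y}"
    and 0: "\<And>j. psi h x y z (fv j) = 0"
  shows "z \<in> vec.span {x, y, cross h x y}"
proof -
  have sorted: "\<forall>i j. i < j \<longrightarrow> (\<forall>k>j. \<forall>l>k. minor4 i j k l x y (cross h x y) z = 0)"
    by (simp add: forall_7 less_7 minor4_cross 0)
  have "minor4 i j k l x y (cross h x y) z = 0" for i j k l
    by (rule sorted_wlog_4[where P = "\<lambda>i j k l. minor4 i j k l x y (cross h x y) z = 0"])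
      (use sorted in \<open>blast intro: minor4_eq_0_swap minor4_swap(4)\<close>)+
  then show ?thesis
    using c unfolding in_span_pair_minor[OF ij] by (blast intro: in_span_tripleI)
qed

lemma block_unique:
  assumes B: "B \<in> frakB eps \<alpha> \<beta> \<gamma>" and xy: "x \<in> B" "y \<in> B" and ij: "minor2 i j x y \<noteq> 0"
    and c: "cross (hval \<alpha> \<beta> \<gamma>) x y \<notin> vec.span {x, y}"
  shows "B = vec.span {x, y, cross (hval \<alpha> \<beta> \<gamma>) x y}"
proof (rule vec.subspace_dim_equal)
  show "B \<subseteq> vec.span {x, y, cross (hval \<alpha> \<beta> \<gamma>) x y}"
    using B xy cross_kernel[OF ij c] unfolding frakB_iff by blast
  show "vec.dim (vec.span {x, y, cross (hval \<alpha> \<beta> \<gamma>) x y}) \<le> vec.dim B"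
    using B dim_span_triple[OF ij c] unfolding frakB_iff by simp
qed (use B in \<open>auto simp: frakB_iff\<close>)

section \<open>Existence of a block through every pair, from skew matrices of odd size\<close>

lemma det_skew_eq_0:
  fixes A :: "'a::field ^ 7 ^ 7"
  assumes two: "(2::'a) \<noteq> 0" and skew: "\<And>i j. A $ i $ j = - A $ j $ i"
  shows "det A = 0"
proof -
  have "A = (\<chi> i. - 1 *s transpose A $ i)"
    by (simp add: vec_eq_iff transpose_def flip: skew)
  then have "det A = det (\<chi> i. - 1 *s transpose A $ i)"
    by (rule arg_cong)
  also have "\<dots> = (\<Prod>i\<in>(UNIV :: 7 set). - 1) * det (\<chi> i. transpose A $ i)"
    by (rule det_rows_mul)
  also have "\<dots> = - det A"
    by simp
  finally have "det A = - det A" .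
  then have "2 * det A = 0"
    unfolding mult_2 by (rule eq_neg_iff_add_eq_0[THEN iffD1])
  then show ?thesis
    using two by simp
qed

lemma kernel_outside_span:
  fixes x y :: "'a::field ^ 7"
  assumes two: "(2::'a) \<noteq> 0" and ij: "minor2 i j x y \<noteq> 0"
  obtains z where "z \<notin> vec.span {x, y}" and "\<And>j. psi h x y z (fv j) = 0"
proof -
  \<comment> \<open>The skew form \<open>psi h x y\<close> is modified by a hyperbolic plane on the coordinates \<open>i, j\<close>: the result is still
      skew of odd size, and its kernel vectors have vanishing coordinates \<open>i, j\<close>, so they avoid \<open>span {x, y}\<close>.\<close>
  define A :: "'a ^ 7 ^ 7" where "A = (\<chi> a b. psi h x y (fv a) (fv b)
    + (if a = i \<and> b = j then 1 else 0) - (if a = j \<and> b = i then 1 else 0))"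
  have "A $ a $ b + A $ b $ a = 0" for a b
    unfolding A_def vec_lambda_beta psi_swap_last[of h x y "fv a" "fv b"]
    by (cases "a = i"; cases "a = j"; cases "b = i"; cases "b = j") simp_all
  then have "A $ a $ b = - A $ b $ a" for a b
    by (simp only: eq_neg_iff_add_eq_0)
  then have "det A = 0"
    by (rule det_skew_eq_0[OF two])
  then obtain z where z: "A *v z = 0" "z \<noteq> 0"
    by (metis invertible_det_nz invertible_left_inverse matrix_left_invertible_ker)
  have row: "psi h x y (fv a) z + (if a = i then z $ j else 0) - (if a = j then z $ i else 0) = 0" for a
  proof -
    have "0 = (\<Sum>b\<in>UNIV. A $ a $ b * z $ b)"
      using z(1) unfolding vec_eq_iff matrix_vector_mult_def by simp
    also have "\<dots> = (\<Sum>b\<in>UNIV. z $ b * psi h x y (fv a) (fv b) +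
        (if b = j then if a = i then z $ j else 0 else 0) - (if b = i then if a = j then z $ i else 0 else 0))"
      by (rule sum.cong) (simp_all add: A_def algebra_simps)
    also have "\<dots> = psi h x y (fv a) z + (if a = i then z $ j else 0) - (if a = j then z $ i else 0)"
      unfolding psi_last[of h x y "fv a" z] by (simp add: sum.distrib sum_subtractf)
    finally show ?thesis by (rule sym)
  qed
  have pair: "psi h x y z w = w $ i * z $ j - w $ j * z $ i" for w
  proof -
    have "psi h x y z w = (\<Sum>a\<in>UNIV. w $ a * psi h x y z (fv a))"
      by (rule psi_last)
    also have "\<dots> = (\<Sum>a\<in>UNIV. (if a = i then w $ i * z $ j else 0) - (if a = j then w $ j * z $ i else 0))"
    proof (rule sum.cong)
      fix a
      have psi_a: "psi h x y z (fv a) = (if a = i then z $ j else 0) - (if a = j then z $ i else 0)"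
        using row[of a] unfolding psi_swap_last[of h x y z "fv a"] by (auto simp: algebra_simps eq_neg_iff_add_eq_0)
      show "w $ a * psi h x y z (fv a) = (if a = i then w $ i * z $ j else 0) - (if a = j then w $ j * z $ i else 0)"
        unfolding psi_a by (cases "a = i"; cases "a = j") (simp_all add: algebra_simps)
    qed simp
    also have "\<dots> = w $ i * z $ j - w $ j * z $ i"
      by (simp add: sum_subtractf)
    finally show ?thesis .
  qed
  \<comment> \<open>Evaluating \<open>pair\<close> at \<open>x\<close> and \<open>y\<close>, where
    the form vanishes, gives a linear system for \<open>z $ i\<close> and \<open>z $ j\<close> with
    determinant \<open>minor2 i j x y\<close> up to sign.\<close>
  have *: "x $ i * z $ j - x $ j * z $ i = 0" "y $ i * z $ j - y $ j * z $ i = 0"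
    by (simp_all only: pair[symmetric] psi_repeat)
  have "minor2 i j x y * z $ i = 0" "minor2 i j x y * z $ j = 0"
    using * unfolding minor2_def by algebra+
  then have zij: "z $ i = 0" "z $ j = 0"
    using ij by simp_all
  show thesis
  proof (rule that)
    show "psi h x y z (fv k) = 0" for k
      by (simp add: pair zij)
    show "z \<notin> vec.span {x, y}"
    proof
      assume "z \<in> vec.span {x, y}"
      then obtain a b where ab: "z = a *s x + b *s y"
        unfolding in_span_pair_iff by blast
      have "minor2 i j x y * a = 0" "minor2 i j x y * b = 0"
        using zij unfolding ab minor2_def vector_add_component vector_smult_component by algebra+
      then show False
        using ij ab z(2) by simp
    qed
  qed
qed

text \<open>The 28 non-collinear triples are handled by \<open>psi\<close> together with the
  off-diagonal entries, the 7 collinear ones by the diagonal entries.\<close>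

lemma minor3_eq_0_if_symmetrization_eq_0:
  fixes x y z :: "'a::field ^ 7"
  assumes two: "(2::'a) \<noteq> 0" and h: "\<And>n. h n \<noteq> 0"
    and psi: "\<And>j. psi h x y z (fv j) = 0"
    and off: "\<And>i j. cross_sym h x y z i j = 0"
    and diag: "\<And>k. cross h x y $ k * z $ k + cross h y z $ k * x $ k + cross h z x $ k * y $ k = 0"
  shows "minor3 i j k x y z = 0"
proof -
  have off: "e = 0" if "cross_sym h x y z i j = h n * e" for i j n e
    using that off[of i j] h[of n] by simp
  \<comment> \<open>For each point \<open>d\<close>, four non-collinear triples form, up to signs, a 4-by-4 Hadamard system, whose
      determinant is a power of 2.\<close>
  note eqs = psi[of 0, unfolded psi_fv] off[OF cross_sym_offdiag(1)] off[OF cross_sym_offdiag(2)] off[OF cross_sym_offdiag(3)]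
  have "2 * 2 * (h 3 * minor3 1 2 5 x y z) = 0"
    "2 * 2 * (h 2 * minor3 1 4 6 x y z) = 0"
    "2 * 2 * (h 5 * minor3 2 3 4 x y z) = 0"
    "2 * 2 * (h 1 * minor3 3 5 6 x y z) = 0"
    using eqs by algebra+
  then have p0: "minor3 1 2 5 x y z = 0" "minor3 1 4 6 x y z = 0" "minor3 2 3 4 x y z = 0" "minor3 3 5 6 x y z = 0"
    using two h by (simp_all only: mult_eq_0_iff simp_thms)
  note eqs = psi[of 1, unfolded psi_fv] off[OF cross_sym_offdiag(4)] off[OF cross_sym_offdiag(5)] off[OF cross_sym_offdiag(6)]
  have "2 * 2 * (h 3 * minor3 0 2 5 x y z) = 0"
    "2 * 2 * (h 2 * minor3 0 4 6 x y z) = 0"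
    "2 * 2 * (h 4 * minor3 2 3 6 x y z) = 0"
    "2 * 2 * (h 6 * minor3 3 4 5 x y z) = 0"
    using eqs by algebra+
  then have p1: "minor3 0 2 5 x y z = 0" "minor3 0 4 6 x y z = 0" "minor3 2 3 6 x y z = 0" "minor3 3 4 5 x y z = 0"
    using two h by (simp_all only: mult_eq_0_iff simp_thms)
  note eqs = psi[of 2, unfolded psi_fv] off[OF cross_sym_offdiag(7)] off[OF cross_sym_offdiag(8)] off[OF cross_sym_offdiag(9)]
  have "2 * 2 * (h 3 * minor3 0 1 5 x y z) = 0"
    "2 * 2 * (h 5 * minor3 0 3 4 x y z) = 0"
    "2 * 2 * (h 4 * minor3 1 3 6 x y z) = 0"
    "2 * 2 * (h 0 * minor3 4 5 6 x y z) = 0"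
    using eqs by algebra+
  then have p2: "minor3 0 1 5 x y z = 0" "minor3 0 3 4 x y z = 0" "minor3 1 3 6 x y z = 0" "minor3 4 5 6 x y z = 0"
    using two h by (simp_all only: mult_eq_0_iff simp_thms)
  note eqs = psi[of 3, unfolded psi_fv] off[OF cross_sym_offdiag(10)] off[OF cross_sym_offdiag(11)] off[OF cross_sym_offdiag(12)]
  have "2 * 2 * (h 5 * minor3 0 2 4 x y z) = 0"
    "2 * 2 * (h 1 * minor3 0 5 6 x y z) = 0"
    "2 * 2 * (h 4 * minor3 1 2 6 x y z) = 0"
    "2 * 2 * (h 6 * minor3 1 4 5 x y z) = 0"
    using eqs by algebra+
  then have p3: "minor3 0 2 4 x y z = 0" "minor3 0 5 6 x y z = 0" "minor3 1 2 6 x y z = 0" "minor3 1 4 5 x y z = 0"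
    using two h by (simp_all only: mult_eq_0_iff simp_thms)
  note eqs = psi[of 4, unfolded psi_fv] off[OF cross_sym_offdiag(13)] off[OF cross_sym_offdiag(14)] off[OF cross_sym_offdiag(15)]
  have "2 * 2 * (h 2 * minor3 0 1 6 x y z) = 0"
    "2 * 2 * (h 5 * minor3 0 2 3 x y z) = 0"
    "2 * 2 * (h 6 * minor3 1 3 5 x y z) = 0"
    "2 * 2 * (h 0 * minor3 2 5 6 x y z) = 0"
    using eqs by algebra+
  then have p4: "minor3 0 1 6 x y z = 0" "minor3 0 2 3 x y z = 0" "minor3 1 3 5 x y z = 0" "minor3 2 5 6 x y z = 0"
    using two h by (simp_all only: mult_eq_0_iff simp_thms)
  note eqs = psi[of 5, unfolded psi_fv] off[OF cross_sym_offdiag(16)] off[OF cross_sym_offdiag(17)] off[OF cross_sym_offdiag(18)]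
  have "2 * 2 * (h 3 * minor3 0 1 2 x y z) = 0"
    "2 * 2 * (h 1 * minor3 0 3 6 x y z) = 0"
    "2 * 2 * (h 6 * minor3 1 3 4 x y z) = 0"
    "2 * 2 * (h 0 * minor3 2 4 6 x y z) = 0"
    using eqs by algebra+
  then have p5: "minor3 0 1 2 x y z = 0" "minor3 0 3 6 x y z = 0" "minor3 1 3 4 x y z = 0" "minor3 2 4 6 x y z = 0"
    using two h by (simp_all only: mult_eq_0_iff simp_thms)
  note eqs = psi[of 6, unfolded psi_fv] off[OF cross_sym_offdiag(19)] off[OF cross_sym_offdiag(20)] off[OF cross_sym_offdiag(21)]
  have "2 * 2 * (h 2 * minor3 0 1 4 x y z) = 0"
    "2 * 2 * (h 1 * minor3 0 3 5 x y z) = 0"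
    "2 * 2 * (h 4 * minor3 1 2 3 x y z) = 0"
    "2 * 2 * (h 0 * minor3 2 4 5 x y z) = 0"
    using eqs by algebra+
  then have p6: "minor3 0 1 4 x y z = 0" "minor3 0 3 5 x y z = 0" "minor3 1 2 3 x y z = 0" "minor3 2 4 5 x y z = 0"
    using two h by (simp_all only: mult_eq_0_iff simp_thms)
  \<comment> \<open>With this scaling, the diagonal equation at a point says that the values
    \<open>q\<close> on the three lines through it sum to zero.\<close>
  define q where "q = (\<lambda>n. minor3 n (n + 1) (n + 3) x y z / h n)"
  have line: "minor3 0 1 3 x y z = h 0 * q 0"
    "minor3 1 2 4 x y z = h 1 * q 1"
    "minor3 2 3 5 x y z = h 2 * q 2"
    "minor3 3 4 6 x y z = h 3 * q 3"
    "minor3 0 4 5 x y z = h 4 * q 4"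
    "minor3 1 5 6 x y z = h 5 * q 5"
    "minor3 0 2 6 x y z = h 6 * q 6"
    using h by (simp_all add: q_def reduce_mod_7) (simp_all add: minor_defs algebra_simps)
  have sum_q: "q 0 + q 6 + q 4 = 0"
    "q 1 + q 0 + q 5 = 0"
    "q 2 + q 1 + q 6 = 0"
    "q 3 + q 2 + q 0 = 0"
    "q 4 + q 3 + q 1 = 0"
    "q 5 + q 4 + q 2 = 0"
    "q 6 + q 5 + q 3 = 0"
  proof -
    have "h 0 * h 6 * h 4 * (q 0 + q 6 + q 4) = 0"
      using diag[of 0] unfolding cross_diag line by algebra
    then show "q 0 + q 6 + q 4 = 0"
      using h by simp
    have "h 1 * h 0 * h 5 * (q 1 + q 0 + q 5) = 0"
      using diag[of 1] unfolding cross_diag line by algebra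
    then show "q 1 + q 0 + q 5 = 0"
      using h by simp
    have "h 2 * h 1 * h 6 * (q 2 + q 1 + q 6) = 0"
      using diag[of 2] unfolding cross_diag line by algebra
    then show "q 2 + q 1 + q 6 = 0"
      using h by simp
    have "h 3 * h 2 * h 0 * (q 3 + q 2 + q 0) = 0"
      using diag[of 3] unfolding cross_diag line by algebra
    then show "q 3 + q 2 + q 0 = 0"
      using h by simp
    have "h 4 * h 3 * h 1 * (q 4 + q 3 + q 1) = 0"
      using diag[of 4] unfolding cross_diag line by algebra
    then show "q 4 + q 3 + q 1 = 0"
      using h by simp
    have "h 5 * h 4 * h 2 * (q 5 + q 4 + q 2) = 0"
      using diag[of 5] unfolding cross_diag line by algebra
    then show "q 5 + q 4 + q 2 = 0"
      using h by simp
    have "h 6 * h 5 * h 3 * (q 6 + q 5 + q 3) = 0"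
      using diag[of 6] unfolding cross_diag line by algebra
    then show "q 6 + q 5 + q 3 = 0"
      using h by simp
  qed
  \<comment> \<open>Adding the equations for the three points of line \<open>n\<close> counts
    \<open>q n\<close> three times and every other line once, since two lines meet in exactly one
    point.\<close>
  define S where "S = (\<Sum>n\<in>UNIV. q n)"
  have sums: "2 * q 0 + S = (q 0 + q 6 + q 4) + (q 1 + q 0 + q 5) + (q 3 + q 2 + q 0)"
    "2 * q 1 + S = (q 1 + q 0 + q 5) + (q 2 + q 1 + q 6) + (q 4 + q 3 + q 1)"
    "2 * q 2 + S = (q 2 + q 1 + q 6) + (q 3 + q 2 + q 0) + (q 5 + q 4 + q 2)"
    "2 * q 3 + S = (q 3 + q 2 + q 0) + (q 4 + q 3 + q 1) + (q 6 + q 5 + q 3)"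
    "2 * q 4 + S = (q 4 + q 3 + q 1) + (q 5 + q 4 + q 2) + (q 0 + q 6 + q 4)"
    "2 * q 5 + S = (q 5 + q 4 + q 2) + (q 6 + q 5 + q 3) + (q 1 + q 0 + q 5)"
    "2 * q 6 + S = (q 6 + q 5 + q 3) + (q 0 + q 6 + q 4) + (q 2 + q 1 + q 6)"
    unfolding S_def sum_7 by algebra+
  have "\<forall>n. 2 * q n + S = 0"
    unfolding forall_7 sums sum_q by simp
  then have "2 * q n = - S" for n
    unfolding eq_neg_iff_add_eq_0 ..
  then have "2 * q n = 2 * q 0" for n
    by simp
  then have q: "q n = q 0" for n
    using two by simp
  \<comment> \<open>The system for the collinear triples is singular in characteristic 3 and gives only that all \<open>q n\<close> are
      equal; a Pluecker relation shows that they vanish.\<close>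
  have "minor3 0 1 3 x y z * minor3 1 2 4 x y z =
      minor3 0 1 2 x y z * minor3 1 3 4 x y z + minor3 0 1 4 x y z * minor3 1 2 3 x y z"
    unfolding minor_defs by algebra
  then have "q 0 = 0"
    unfolding line q[of 1] p5 p6 using h by simp
  then have lines: "minor3 0 1 3 x y z = 0" "minor3 1 2 4 x y z = 0" "minor3 2 3 5 x y z = 0"
      "minor3 3 4 6 x y z = 0" "minor3 0 4 5 x y z = 0" "minor3 1 5 6 x y z = 0" "minor3 0 2 6 x y z = 0"
    using q unfolding line by simp_all
  have sorted: "\<forall>i j. i < j \<longrightarrow> (\<forall>k>j. minor3 i j k x y z = 0)"
    by (simp add: forall_7 less_7 lines p0 p1 p2 p3 p4 p5 p6)
  show ?thesis
    by (rule sorted_wlog_3[where P = "\<lambda>i j k. minor3 i j k x y z = 0"])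
      (use sorted in \<open>blast intro: minor3_eq_0_swap minor3_swap(3)\<close>)+
qed

section \<open>Products inside and outside the span of their factors\<close>

lemma combination_eqD:
  fixes x y z :: "'a::field ^ 'n::finite"
  assumes "minor2 i j x y \<noteq> 0" and "z \<notin> vec.span {x, y}"
    and eq: "a *s x + b *s y + c *s z = a' *s x + b' *s y + c' *s z"
  shows "a = a'" "b = b'" "c = c'"
proof -
  obtain k where k: "minor3 i j k x y z \<noteq> 0"
    using assms(1,2) in_span_pair_minor by blast
  have comp: "a * x $ l + b * y $ l + c * z $ l = a' * x $ l + b' * y $ l + c' * z $ l" for l
    using arg_cong[OF eq, of "\<lambda>u. u $ l"] by simp
  have "a * minor3 i j k x y z = a' * minor3 i j k x y z" "b * minor3 i j k x y z = b' * minor3 i j k x y z"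
    "c * minor3 i j k x y z = c' * minor3 i j k x y z"
    using comp[of i] comp[of j] comp[of k] unfolding minor_defs by algebra+
  then show "a = a'" "b = b'" "c = c'"
    using k by simp_all
qed

lemma cross_in_span_if_minor2_eq_0:
  assumes "\<And>i j. minor2 i j x y = 0"
  shows "cross h x y \<in> vec.span {x, y}"
proof -
  have "cross h x y = 0"
    by (simp add: cross_def assms vec_eq_iff)
  then show ?thesis
    by (simp add: vec.span_zero)
qed

text \<open>If every product stayed in the span of its factors, testing sums of basis vectors would
  tie the coefficients of the three basic products together. The symmetrized product then cancels,
  and \<open>x\<close>, \<open>y\<close>, \<open>z\<close> would be dependent.\<close>

lemma cross_outside_span:
  fixes x y z :: "'a::field ^ 7"
  assumes two: "(2::'a) \<noteq> 0" and h: "\<And>n. h n \<noteq> 0"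
    and ij: "minor2 i j x y \<noteq> 0" and z: "z \<notin> vec.span {x, y}"
    and psi: "\<And>j. psi h x y z (fv j) = 0"
  shows "\<exists>u\<in>vec.span {x, y, z}. \<exists>v\<in>vec.span {x, y, z}. cross h u v \<notin> vec.span {u, v}"
proof (rule ccontr)
  assume "\<not> ?thesis"
  then have closed: "cross h u v \<in> vec.span {u, v}"
    if "u \<in> vec.span {x, y, z}" "v \<in> vec.span {x, y, z}" for u v
    using that by blast
  have mem: "x \<in> vec.span {x, y, z}" "y \<in> vec.span {x, y, z}" "z \<in> vec.span {x, y, z}"
    by (simp_all add: vec.span_base)
  obtain a b where ab: "cross h x y = a *s x + b *s y"
    using closed[OF mem(1,2)] unfolding in_span_pair_iff by blast
  obtain c d where cd: "cross h y z = c *s y + d *s z"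
    using closed[OF mem(2,3)] unfolding in_span_pair_iff by blast
  obtain e f where ef: "cross h z x = e *s z + f *s x"
    using closed[OF mem(3,1)] unfolding in_span_pair_iff by blast
  \<comment> \<open>A product in the span of \<open>x + z\<close> and \<open>y\<close> has equal
    coefficients at \<open>x\<close> and \<open>z\<close>; the next two tests are the cyclic
    analogues.\<close>
  obtain s t where "cross h (x + z) y = s *s (x + z) + t *s y"
    using closed[OF vec.span_add[OF mem(1,3)] mem(2)] unfolding in_span_pair_iff by blast
  moreover have "cross h (x + z) y = cross h x y - cross h y z"
    by (simp add: vec_eq_iff cross_def minor2_def algebra_simps)
  ultimately have 1: "a *s x + (b - c) *s y + (- d) *s z = s *s x + t *s y + s *s z"
    unfolding ab cd by (simp add: vec_eq_iff algebra_simps)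
  have "a = - d"
    using combination_eqD(1,3)[OF ij z 1] by simp
  then have d: "d = - a"
    by simp
  obtain s t where "cross h x (y + z) = s *s x + t *s (y + z)"
    using closed[OF mem(1) vec.span_add[OF mem(2,3)]] unfolding in_span_pair_iff by blast
  moreover have "cross h x (y + z) = cross h x y - cross h z x"
    by (simp add: vec_eq_iff cross_def minor2_def algebra_simps)
  ultimately have 2: "(a - f) *s x + b *s y + (- e) *s z = s *s x + t *s y + t *s z"
    unfolding ab ef by (simp add: vec_eq_iff algebra_simps)
  have "b = - e"
    using combination_eqD(2,3)[OF ij z 2] by simp
  then have e: "e = - b"
    by simp
  obtain s t where "cross h (x + y) z = s *s (x + y) + t *s z"
    using closed[OF vec.span_add[OF mem(1,2)] mem(3)] unfolding in_span_pair_iff by blast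
  moreover have "cross h (x + y) z = cross h y z - cross h z x"
    by (simp add: vec_eq_iff cross_def minor2_def algebra_simps)
  ultimately have 3: "(- f) *s x + c *s y + (d - e) *s z = s *s x + s *s y + t *s z"
    unfolding cd ef by (simp add: vec_eq_iff algebra_simps)
  have "c = - f"
    using combination_eqD(1,2)[OF ij z 3] by simp
  then have f: "f = - c"
    by simp
  have "minor3 i j k x y z = 0" for k
  proof (rule minor3_eq_0_if_symmetrization_eq_0[OF two h psi])
    show "cross_sym h x y z i j = 0" for i j
      unfolding cross_sym_def ab cd ef d e f by (simp add: algebra_simps)
    show "cross h x y $ k * z $ k + cross h y z $ k * x $ k + cross h z x $ k * y $ k = 0" for k
      unfolding ab cd ef d e f by (simp add: algebra_simps)
  qed
  then show False
    using z unfolding in_span_pair_minor[OF ij] by blast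
qed

text \<open>If the product is \<open>a *s x + b *s y\<close>, multiplying by \<open>x\<close> once
  more gives \<open>b\<close> times the product, because the product of \<open>x\<close> with itself
  is zero. Comparing coefficients of \<open>y\<close> with \<open>cross_cross\<close> yields the
  equation.\<close>

lemma cross_in_span_isotropic:
  fixes x y :: "'a::field ^ 7"
  assumes ij: "minor2 i j x y \<noteq> 0" and "cross h x y \<in> vec.span {x, y}"
  obtains b where "b\<^sup>2 + polar h x x = 0"
proof -
  obtain a b where ab: "cross h x y = a *s x + b *s y"
    using assms(2) unfolding in_span_pair_iff by blast
  have "cross h x (a *s x + b *s y) = b *s cross h x y"
    by (simp add: vec_eq_iff cross_def minor2_def algebra_simps)
  then have "cross h x (cross h x y) = b *s cross h x y"
    by (simp only: ab)
  then have eq: "b * (a * x $ k + b * y $ k) = polar h x y * x $ k - polar h x x * y $ k" for k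
    unfolding cross_cross unfolding ab by (simp add: vec_eq_iff algebra_simps)
  have "minor2 i j x y * (b\<^sup>2 + polar h x x) = 0"
    using eq[of i] eq[of j] unfolding minor2_def power2_eq_square by algebra
  then show thesis
    using ij that by simp
qed

text \<open>This makes each block indispensable: \<open>cross_outside_span\<close> finds a pair in
  \<open>B\<close> whose product leaves its span, and by \<open>block_unique\<close> no other block
  contains that pair.\<close>

lemma block_determined_by_pair:
  fixes \<alpha> \<beta> \<gamma> :: "'a::field"
  assumes two: "(2::'a) \<noteq> 0" and h: "\<And>n. hval \<alpha> \<beta> \<gamma> n \<noteq> 0" and B: "B \<in> frakB eps \<alpha> \<beta> \<gamma>"
  obtains T where "vec.subspace T" "vec.dim T = 2"
    "\<And>B'. B' \<in> frakB eps \<alpha> \<beta> \<gamma> \<Longrightarrow> T \<subseteq> B' \<Longrightarrow> B' = B"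
proof -
  obtain x y z i j where xyz: "B = vec.span {x, y, z}" and ij: "minor2 i j x y \<noteq> 0" and z: "z \<notin> vec.span {x, y}"
    using subspace_dim_3E[of B] B unfolding frakB_iff by metis
  have "psi (hval \<alpha> \<beta> \<gamma>) x y z (fv j) = 0" for j
    using B unfolding frakB_iff by (simp add: xyz vec.span_base)
  then obtain u v where uv: "u \<in> B" "v \<in> B" and c: "cross (hval \<alpha> \<beta> \<gamma>) u v \<notin> vec.span {u, v}"
    using cross_outside_span[where h = "hval \<alpha> \<beta> \<gamma>", OF two h ij z] xyz by blast
  obtain k l where kl: "minor2 k l u v \<noteq> 0"
    using c cross_in_span_if_minor2_eq_0 by blast
  have unique: "B' = vec.span {u, v, cross (hval \<alpha> \<beta> \<gamma>) u v}" if "B' \<in> frakB eps \<alpha> \<beta> \<gamma>" "vec.span {u, v} \<subseteq> B'" for B'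
    using that by (intro block_unique[OF _ _ _ kl c]) (auto intro: vec.span_base)
  have "vec.span {u, v} \<subseteq> B"
    using uv B unfolding frakB_iff by (intro vec.span_minimal) auto
  then have "B' = B" if "B' \<in> frakB eps \<alpha> \<beta> \<gamma>" "vec.span {u, v} \<subseteq> B'" for B'
    using unique[OF that] unique[OF B] by simp
  then show thesis
    using dim_span_pair[OF kl] by (intro that[of "vec.span {u, v}"]) auto
qed

text \<open>This is the octonion norm on imaginary elements. Coordinate 6 carries \<gamma>\<alpha>
  and coordinate 5 carries \<alpha>\<beta>\<gamma>, hence the reversed order of the last two
  terms.\<close>

lemma polar_hval:
  "polar (hval \<alpha> \<beta> \<gamma>) x x = - (x $ 0)\<^sup>2 * \<alpha> - (x $ 1)\<^sup>2 * \<beta> - (x $ 2)\<^sup>2 * \<gamma>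
    + (x $ 3)\<^sup>2 * \<alpha> * \<beta> + (x $ 4)\<^sup>2 * \<beta> * \<gamma> + (x $ 6)\<^sup>2 * \<gamma> * \<alpha> - (x $ 5)\<^sup>2 * \<alpha> * \<beta> * \<gamma>"
proof -
  have "(- 1 :: 7) = 6"
    by simp
  then show ?thesis
    by (simp add: polar_def sum_7 reduce_mod_7 hval_def power2_eq_square algebra_simps)
qed

theorem mainTheorem4:
  fixes \<alpha> \<beta> \<gamma> :: "'a::field" and eps :: nat
  assumes "(2::'a) \<noteq> 0"
    and "\<alpha> \<noteq> 0" and "\<beta> \<noteq> 0" and "\<gamma> \<noteq> 0"
    and "eps = 0 \<or> eps = 1"
  shows "min_q_covering (frakB eps \<alpha> \<beta> \<gamma>) 3 2 \<and>
    ((\<forall>l0 l1 l2 l3 l4 l5 l6 l7 :: 'a.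
        l0^2 - l1^2 * \<alpha> - l2^2 * \<beta> - l3^2 * \<gamma> + l4^2 * \<alpha> * \<beta> + l5^2 * \<beta> * \<gamma>
          + l6^2 * \<gamma> * \<alpha> - l7^2 * \<alpha> * \<beta> * \<gamma> = 0
        \<longrightarrow> l0 = 0 \<and> l1 = 0 \<and> l2 = 0 \<and> l3 = 0 \<and> l4 = 0 \<and> l5 = 0 \<and> l6 = 0 \<and> l7 = 0)
     \<longrightarrow> q_steiner (frakB eps \<alpha> \<beta> \<gamma>) 3 2)"
proof -
  define h where "h = hval \<alpha> \<beta> \<gamma>"
  have h: "h n \<noteq> 0" for n
    using assms by (simp add: h_def hval_def)
  have blocks: "vec.subspace B \<and> vec.dim B = 3" if "B \<in> frakB eps \<alpha> \<beta> \<gamma>" for B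
    using that by (simp add: frakB_def)
  have cover: "\<exists>B\<in>frakB eps \<alpha> \<beta> \<gamma>. T \<subseteq> B" if T2: "vec.subspace T" "vec.dim T = 2" for T
  proof -
    obtain x y i j where T: "T = vec.span {x, y}" and ij: "minor2 i j x y \<noteq> 0"
      using subspace_dim_2E[OF T2] by blast
    obtain z where z: "z \<notin> vec.span {x, y}" "\<And>j. psi h x y z (fv j) = 0"
      using kernel_outside_span[OF assms(1) ij] by blast
    have "vec.span {x, y, z} \<in> frakB eps \<alpha> \<beta> \<gamma>"
      using span_triple_in_frakB[OF ij z(1)] z(2) unfolding h_def by blast
    moreover have "T \<subseteq> vec.span {x, y, z}"
      unfolding T by (rule vec.span_mono) auto
    ultimately show ?thesis by blast
  qed
  have minimal: "\<not> q_covering \<C> 3 2" if proper: "\<C> \<subset> frakB eps \<alpha> \<beta> \<gamma>" for \<C>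
  proof
    assume cov: "q_covering \<C> 3 2"
    obtain B where B: "B \<in> frakB eps \<alpha> \<beta> \<gamma>" "B \<notin> \<C>"
      using proper by blast
    obtain T where T: "vec.subspace T" "vec.dim T = 2"
      and unique: "\<And>B'. B' \<in> frakB eps \<alpha> \<beta> \<gamma> \<Longrightarrow> T \<subseteq> B' \<Longrightarrow> B' = B"
      using block_determined_by_pair[OF assms(1) h[unfolded h_def] B(1)] by blast
    obtain B' where "B' \<in> \<C>" "T \<subseteq> B'"
      using cov T unfolding q_covering_def by blast
    then show False
      using unique B(2) proper by blast
  qed
  have steiner: "q_steiner (frakB eps \<alpha> \<beta> \<gamma>) 3 2"
    if aniso: "\<forall>l0 l1 l2 l3 l4 l5 l6 l7 :: 'a.
        l0^2 - l1^2 * \<alpha> - l2^2 * \<beta> - l3^2 * \<gamma> + l4^2 * \<alpha> * \<beta> + l5^2 * \<beta> * \<gamma>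
          + l6^2 * \<gamma> * \<alpha> - l7^2 * \<alpha> * \<beta> * \<gamma> = 0
        \<longrightarrow> l0 = 0 \<and> l1 = 0 \<and> l2 = 0 \<and> l3 = 0 \<and> l4 = 0 \<and> l5 = 0 \<and> l6 = 0 \<and> l7 = 0"
    unfolding q_steiner_def
  proof (intro conjI ballI allI impI)
    fix T :: "('a ^ 7) set" assume T: "vec.subspace T \<and> vec.dim T = 2"
    then obtain x y i j where xy: "T = vec.span {x, y}" and ij: "minor2 i j x y \<noteq> 0"
      using subspace_dim_2E by metis
    have c: "cross h x y \<notin> vec.span {x, y}"
    proof
      assume "cross h x y \<in> vec.span {x, y}"
      then obtain b where "b\<^sup>2 + polar h x x = 0"
        using cross_in_span_isotropic[OF ij] by blast
      then have "b\<^sup>2 - (x $ 0)\<^sup>2 * \<alpha> - (x $ 1)\<^sup>2 * \<beta> - (x $ 2)\<^sup>2 * \<gamma> + (x $ 3)\<^sup>2 * \<alpha> * \<beta>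
          + (x $ 4)\<^sup>2 * \<beta> * \<gamma> + (x $ 6)\<^sup>2 * \<gamma> * \<alpha> - (x $ 5)\<^sup>2 * \<alpha> * \<beta> * \<gamma> = 0"
        unfolding h_def polar_hval by (simp add: algebra_simps)
      \<comment> \<open>Here \<open>b\<close> serves as \<open>l0\<close>, \<open>x $ 6\<close> as
        \<open>l6\<close> and \<open>x $ 5\<close> as \<open>l7\<close>; the conclusion
        \<open>x = 0\<close> contradicts the nonzero 2-minor.\<close>
      then have "x $ 0 = 0 \<and> x $ 1 = 0 \<and> x $ 2 = 0 \<and> x $ 3 = 0 \<and> x $ 4 = 0 \<and> x $ 6 = 0 \<and> x $ 5 = 0"
        using aniso[rule_format, of b "x $ 0" "x $ 1" "x $ 2" "x $ 3" "x $ 4" "x $ 6" "x $ 5"] by blast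
      then have "\<forall>k. x $ k = 0"
        unfolding forall_7 by blast
      then show False
        using ij by (simp add: minor2_def)
    qed
    have "x \<in> T" "y \<in> T"
      unfolding xy by (simp_all add: vec.span_base)
    then have "B = vec.span {x, y, cross h x y}" if "B \<in> frakB eps \<alpha> \<beta> \<gamma>" "T \<subseteq> B" for B
      using block_unique[OF that(1) _ _ ij] that(2) c unfolding h_def by blast
    moreover obtain B where "B \<in> frakB eps \<alpha> \<beta> \<gamma>" "T \<subseteq> B"
      using cover T by blast
    ultimately show "\<exists>!B. B \<in> frakB eps \<alpha> \<beta> \<gamma> \<and> T \<subseteq> B"
      by metis
  qed (use blocks in blast)+
  show ?thesis
    unfolding min_q_covering_def q_covering_def[of "frakB eps \<alpha> \<beta> \<gamma>"]
    using blocks cover minimal steiner by blast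
qed

end
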